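(* Let $d\ge 1$ and let $\Sigma$ be a $d$-dimensional simplicial complex on $n$ vertices which is a basis in the $d$-dimensional volume rigidity matroid $\mathcal{R}_n^d$ (that is, its set $\Sigma_d$ of $d$-simplices is a basis of $\mathcal{R}_n^d$). Then, for all $0\leq k\leq d$, $$f(\Sigma)_k\;\geq\; \binom{d+1}{k+1}+\sum_{l=0}^{d-1}(n-d-1)\binom{d-l}{k-l}.$$ Moreover, this bound is sharp: for all $d\ge 1$, $n\ge d+1$ and $0\le k\le d$ there is a $d$-dimensional simplicial complex on $n$ vertices that is a basis in $\mathcal{R}_n^d$ and for which equality holds.
   Context: A simplicial complex $\Sigma$ on $n$ vertices is a collection of subsets of $[n]=\{1,\dots,n\}$ closed under taking subsets, with vertex set $[n]$. A $k$-simplex is an element of $\Sigma$ of size $k+1$; $\Sigma_k$ is the set of $k$-simplices and $f(\Sigma)_k=|\Sigma_k|$ for $k\ge 0$. $\Sigma$ is $d$-dimensional if $d$ is the largest integer such that $\Sigma$ contains a $d$-simplex. All $d$-dimensional complexes are assumed pure: every simplex is contained in a $d$-simplex. Convention: $\binom{a}{b}=0$ if $b<0$. Volume rigidity matroid: let $\alpha_n^d:(\mathbb{R}^d)^n\to\mathbb{R}^{\binom{[n]}{d+1}}$ be the polynomial map sending $p=(p(1),\dots,p(n))$ to the vector with entries $$\begin{vmatrix}1&\dots&1\\ p(i_1)&\dots&p(i_{d+1})\end{vmatrix},\qquad i_1<\dots<i_{d+1},\ \{i_1,\dots,i_{d+1}\}\in\tbinom{[n]}{d+1}.$$ The rigidity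 matrix $R(p)$ is the Jacobian matrix of $\alpha_n^d$ at $p$, with rows indexed by $\binom{[n]}{d+1}$ and $dn$ columns. A configuration $p\in(\mathbb{R}^d)^n$ is generic if no nonzero polynomial in $dn$ variables with rational coefficients vanishes at $p$. The matroid $\mathcal{R}_n^d$ on the ground set $\binom{[n]}{d+1}$ is the row matroid of $R(p)$ for any generic $p$ (a set is independent iff the corresponding rows of $R(p)$ are linearly independent); it does not depend on the choice of the generic $p$. *)

theory Defs
  imports "HOL-Analysis.Derivative" "HOL-Library.Poly_Mapping" "Jordan_Normal_Form.Determinant"
begin

section \<open>Simplicial complexes on the vertex set \<open>{1..n}\<close>\<close>

definition simplices :: "nat set set \<Rightarrow> nat \<Rightarrow> nat set set" where
  "simplices \<Sigma> k = {\<sigma> \<in> \<Sigma>. card \<sigma> = k + 1}"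

definition f_vec :: "nat set set \<Rightarrow> nat \<Rightarrow> nat" where
  "f_vec \<Sigma> k = card (simplices \<Sigma> k)"

definition simplicial_complex :: "nat \<Rightarrow> nat set set \<Rightarrow> bool" where
  "simplicial_complex n \<Sigma> \<longleftrightarrow>
     (\<forall>\<sigma>\<in>\<Sigma>. \<forall>\<tau>. \<tau> \<subseteq> \<sigma> \<longrightarrow> \<tau> \<in> \<Sigma>) \<and> \<Union>\<Sigma> = {1..n}"

text \<open>Complexes of dimension \<open>d\<close> are pure by convention.\<close>

definition dim_complex :: "nat \<Rightarrow> nat \<Rightarrow> nat set set \<Rightarrow> bool" where
  "dim_complex n d \<Sigma> \<longleftrightarrow>
     simplicial_complex n \<Sigma> \<and>
     simplices \<Sigma> d \<noteq> {} \<and> (\<forall>k>d. simplices \<Sigma> k = {}) \<and>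
     (\<forall>\<sigma>\<in>\<Sigma>. \<exists>\<tau>\<in>simplices \<Sigma> d. \<sigma> \<subseteq> \<tau>)"

section \<open>The volume rigidity matroid\<close>

text \<open>
  A configuration of \<open>n\<close> points in d-dimensional real space is a function \<open>p\<close>, where \<open>p i j\<close>
  is the \<open>j\<close>-th coordinate of the \<open>i\<close>-th point. Only the values with \<open>i \<in> {1..n}\<close> and
  \<open>j \<in> {1..d}\<close> matter.
\<close>

type_synonym config = "nat \<Rightarrow> nat \<Rightarrow> real"

text \<open>
  Polynomials with rational coefficients in variables indexed by pairs \<open>(i, j)\<close>: finitely
  supported maps from monomials (finitely supported exponent maps) to coefficients.
\<close>

type_synonym rat_mpoly = "((nat \<times> nat) \<Rightarrow>\<^sub>0 nat) \<Rightarrow>\<^sub>0 rat"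

definition mpoly_vars :: "rat_mpoly \<Rightarrow> (nat \<times> nat) set" where
  "mpoly_vars f = (\<Union>m \<in> Poly_Mapping.keys f. Poly_Mapping.keys m)"

definition mpoly_eval :: "config \<Rightarrow> rat_mpoly \<Rightarrow> real" where
  "mpoly_eval p f =
     (\<Sum>m \<in> Poly_Mapping.keys f. of_rat (Poly_Mapping.lookup f m) *
        (\<Prod>(i, j) \<in> Poly_Mapping.keys m. p i j ^ Poly_Mapping.lookup m (i, j)))"

definition generic :: "nat \<Rightarrow> nat \<Rightarrow> config \<Rightarrow> bool" where
  "generic n d p \<longleftrightarrow>
     (\<forall>f. f \<noteq> 0 \<and> mpoly_vars f \<subseteq> {1..n} \<times> {1..d} \<longrightarrow> mpoly_eval p f \<noteq> 0)"

definition ground_set :: "nat \<Rightarrow> nat \<Rightarrow> nat set set" where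
  "ground_set n d = {\<sigma>. \<sigma> \<subseteq> {1..n} \<and> card \<sigma> = d + 1}"

text \<open>
  The \<open>\<sigma>\<close>-entry of the volume map at \<open>p\<close>: row 0 of the matrix consists of ones, and below it
  the columns are the points \<open>p i\<close> for the elements \<open>i\<close> of \<open>\<sigma>\<close> in increasing order.
\<close>

definition volume_map :: "nat \<Rightarrow> config \<Rightarrow> nat set \<Rightarrow> real" where
  "volume_map d p \<sigma> =
     Determinant.det (Matrix.mat (d + 1) (d + 1)
       (\<lambda>(r, c). if r = 0 then 1 else p (sorted_list_of_set \<sigma> ! c) r))"

text \<open>The Jacobian of the volume map; the column \<open>(i, j)\<close> belongs to the coordinate \<open>p i j\<close>.\<close>

definition rigidity_matrix :: "nat \<Rightarrow> config \<Rightarrow> nat set \<Rightarrow> nat \<times> nat \<Rightarrow> real" where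
  "rigidity_matrix d p \<sigma> =
     (\<lambda>(i, j). deriv (\<lambda>t. volume_map d (p(i := (p i)(j := t))) \<sigma>) (p i j))"

definition rows_independent :: "nat \<Rightarrow> nat \<Rightarrow> config \<Rightarrow> nat set set \<Rightarrow> bool" where
  "rows_independent n d p S \<longleftrightarrow>
     (\<forall>c :: nat set \<Rightarrow> real.
        (\<forall>v \<in> {1..n} \<times> {1..d}. (\<Sum>\<sigma>\<in>S. c \<sigma> * rigidity_matrix d p \<sigma> v) = 0)
          \<longrightarrow> (\<forall>\<sigma>\<in>S. c \<sigma> = 0))"

text \<open>
  The independent sets of the row matroid of the rigidity matrix at \<open>p\<close>. For generic \<open>p\<close> this is
  the volume rigidity matroid, which does not depend on the choice of \<open>p\<close>.
\<close>

definition rigidity_matroid :: "nat \<Rightarrow> nat \<Rightarrow> config \<Rightarrow> nat set set set" where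
  "rigidity_matroid n d p = {S. S \<subseteq> ground_set n d \<and> rows_independent n d p S}"

definition basis_of :: "'a set set \<Rightarrow> 'a set \<Rightarrow> bool" where
  "basis_of I B \<longleftrightarrow> B \<in> I \<and> (\<forall>S\<in>I. B \<subseteq> S \<longrightarrow> S = B)"

text \<open>
  Binomial coefficient with both arguments given as differences; it vanishes if the lower
  difference \<open>k - l\<close> is negative, which truncated subtraction would turn into 0. The truncated
  \<open>n - d - 1\<close> below is harmless, as a d-dimensional complex has at least \<open>d + 1\<close> vertices.
\<close>

definition shifted_binomial :: "nat \<Rightarrow> nat \<Rightarrow> nat \<Rightarrow> nat" where
  "shifted_binomial d k l = (if l \<le> k then (d - l) choose (k - l) else 0)"

definition face_bound :: "nat \<Rightarrow> nat \<Rightarrow> nat \<Rightarrow> nat" where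
  "face_bound n d k =
     ((d + 1) choose (k + 1)) + (\<Sum>l = 0..<d. (n - d - 1) * shifted_binomial d k l)"

end

theory Submission imports Defs begin

text \<open>
  Put \<open>D = {1..d + 1}\<close>. Let \<open>f\<^sub>1\<close> be the all-ones vector of length \<open>n\<close>, let
  \<open>f\<^sub>2, \<dots>, f\<^bsub>d + 1\<^esub>\<close> be the \<open>d\<close> coordinate vectors of the configuration, and let
  \<open>f\<^sub>m\<close> be the unit vector \<open>e\<^sub>m\<close> for \<open>m > d + 1\<close>; write \<open>f\<^sub>S\<close> for the exterior product
  of the \<open>f\<^sub>s\<close> with \<open>s \<in> S\<close>. The signed volume of \<open>\<sigma>\<close> is the \<open>\<sigma>\<close>-coordinate of \<open>f\<^sub>D\<close>, and
  differentiating it by the \<open>j\<close>-th coordinate of the \<open>i\<close>-th point replaces the factor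
  \<open>f\<^bsub>j + 1\<^esub>\<close> by \<open>e\<^sub>i\<close>. So, up to sign, the columns of the rigidity matrix are the products
  of \<open>f\<^bsub>D - {j}\<^esub>\<close> with \<open>e\<^sub>i\<close>, for \<open>2 \<le> j \<le> d + 1\<close>. If the first \<open>d + 1\<close> points are affinely
  independent, which holds for generic configurations (\<open>generic_volume_nonzero\<close>), the
  \<open>f\<^sub>i\<close> form a basis of the whole space, and the columns span the same space as the \<open>f\<^sub>F\<close>
  where \<open>F\<close> is \<open>D\<close> or \<open>D - {j} \<union> {m}\<close> with \<open>2 \<le> j \<le> d + 1 < m\<close>
  (\<open>rigidity_stress_iff\<close>). These \<open>F\<close> are the facets of a shifted complex \<open>C\<close>.

  The vectors \<open>f\<^sub>F\<close> stay independent when all coordinates except those in \<open>C\<close> are dropped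
  (\<open>facet_wedges_independent\<close>). So the facets of \<open>C\<close> form a basis of the matroid, and counting
  the faces of \<open>C\<close> shows that \<open>C\<close> attains the bound (\<open>f_vec_shifted_complex\<close>).

  For the inequality let the \<open>d\<close>-simplices of \<open>\<Sigma>\<close> be any basis. The rows of a basis detect every
  relation between columns, so the \<open>f\<^sub>F\<close> are also independent on the \<open>d\<close>-simplices of \<open>\<Sigma>\<close>.
  Multiplication by \<open>f\<^sub>r\<close> turns a vector that vanishes on the \<open>k\<close>-simplices of \<open>\<Sigma>\<close> into one
  that vanishes on the \<open>(k + 1)\<close>-simplices, because \<open>\<Sigma>\<close> is closed under subsets, and it maps
  \<open>f\<^sub>S\<close> to \<open>0\<close> or to \<open>f\<^bsub>S \<union> {r}\<^esub>\<close> up to sign. By downward induction on \<open>k\<close>, the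
  \<open>f\<^sub>S\<close> for the \<open>k\<close>-faces \<open>S\<close> of \<open>C\<close> are independent on the \<open>k\<close>-simplices of \<open>\<Sigma>\<close>
  (\<open>shifted_wedges_independent_on_complex\<close>). Hence \<open>\<Sigma>\<close> has at least as many \<open>k\<close>-simplices as
  \<open>C\<close>. This is the mechanism of exterior algebraic shifting, restricted to the faces that matter
  here.
\<close>

section \<open>Relations between rows and columns of a matrix\<close>

definition independent_rows :: "('r \<Rightarrow> 'c \<Rightarrow> real) \<Rightarrow> 'c set \<Rightarrow> 'r set \<Rightarrow> bool" where
  "independent_rows M C S \<longleftrightarrow>
     (\<forall>a. (\<forall>c\<in>C. (\<Sum>r\<in>S. a r * M r c) = 0) \<longrightarrow> (\<forall>r\<in>S. a r = 0))"

text \<open>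
  Gaussian elimination: an unknown \<open>w\<close> with nonzero coefficient in some equation is eliminated from
  the others, which loses one unknown and one equation.
\<close>

lemma homogeneous_system_nontrivial_solution:
  assumes "finite E" "finite U" "card E < card U"
  shows "\<exists>a::'u \<Rightarrow> real. (\<exists>u\<in>U. a u \<noteq> 0) \<and> (\<forall>e\<in>E. (\<Sum>u\<in>U. a u * M u e) = 0)"
  using assms
proof (induction E arbitrary: U M rule: finite_induct)
  case empty
  then obtain u where "u \<in> U"
    by (metis card.empty card_gt_0_iff equals0I)
  then show ?case
    by (intro exI[of _ "\<lambda>_. 1"]) auto
next
  case (insert e E)
  show ?case
  proof (cases "\<forall>u\<in>U. M u e = 0")
    case True
    moreover obtain a where "\<exists>u\<in>U. a u \<noteq> 0" "\<forall>e\<in>E. (\<Sum>u\<in>U. a u * M u e) = 0"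
      using insert.IH[of U M] insert.prems insert.hyps by auto
    ultimately show ?thesis
      by (intro exI[of _ a]) auto
  next
    case False
    then obtain w where w: "w \<in> U" "M w e \<noteq> 0"
      by blast
    let ?U = "U - {w}"
    have "card E < card ?U"
      using insert.prems insert.hyps w by simp
    then obtain a where a: "\<exists>u\<in>?U. a u \<noteq> 0"
      and sol: "\<And>e'. e' \<in> E \<Longrightarrow> (\<Sum>u\<in>?U. a u * (M u e' - M w e' * (M u e / M w e))) = 0"
      using insert.IH[of ?U "\<lambda>u e'. M u e' - M w e' * (M u e / M w e)"] insert.prems by auto
    define b where "b = a(w := - (\<Sum>u\<in>?U. a u * (M u e / M w e)))"
    have split: "(\<Sum>u\<in>U. b u * M u e') = b w * M w e' + (\<Sum>u\<in>?U. a u * M u e')" for e'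
      using insert.prems w by (subst sum.remove[of U w]) (auto simp: b_def intro!: sum.cong)
    have "(\<Sum>u\<in>U. b u * M u e') = 0" if "e' \<in> insert e E" for e'
    proof (cases "e' = e")
      case True
      have "(\<Sum>u\<in>?U. a u * (M u e / M w e)) * M w e = (\<Sum>u\<in>?U. a u * M u e)"
        using w by (subst sum_distrib_right) simp
      then show ?thesis
        using split[of e] True by (simp add: b_def)
    next
      case False
      then have "(\<Sum>u\<in>?U. a u * M u e') = (\<Sum>u\<in>?U. a u * (M u e / M w e)) * M w e'"
        using sol[of e'] that
        by (simp add: algebra_simps sum_subtractf sum_distrib_left)
      then show ?thesis
        using split[of e'] by (simp add: b_def)
    qed
    moreover have "\<exists>u\<in>U. b u \<noteq> 0"
      using a by (auto simp: b_def)
    ultimately show ?thesis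
      by blast
  qed
qed

lemma independent_rows_card_le:
  assumes "independent_rows M C S" "finite S" "finite C"
  shows "card S \<le> card C"
  using homogeneous_system_nontrivial_solution[of C S M] assms
  unfolding independent_rows_def by (metis not_le)

text \<open>
  A nontrivial relation among the rows makes one row redundant. The remaining equations are fewer
  than the columns, so they have a nontrivial solution, which then solves the redundant equation too
  and is a relation among the columns.
\<close>

lemma independent_rows_transpose_square:
  assumes "independent_rows (\<lambda>c r. M r c) S C" "finite S" "finite C" "card S = card C"
  shows "independent_rows M C S"
  unfolding independent_rows_def
proof (intro allI impI ballI, rule ccontr)
  fix a r
  assume rel: "\<forall>c\<in>C. (\<Sum>r\<in>S. a r * M r c) = 0" and r: "r \<in> S" "a r \<noteq> 0"
  have "card (S - {r}) < card C"
    using assms r by (metis card_Diff1_less)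
  then obtain b where b: "\<exists>c\<in>C. b c \<noteq> 0"
    and zero: "\<And>s. s \<in> S - {r} \<Longrightarrow> (\<Sum>c\<in>C. b c * M s c) = 0"
    using homogeneous_system_nontrivial_solution[of "S - {r}" C "\<lambda>c r. M r c"] assms by auto
  have "0 = (\<Sum>c\<in>C. b c * (\<Sum>s\<in>S. a s * M s c))"
    using rel by simp
  also have "\<dots> = (\<Sum>s\<in>S. a s * (\<Sum>c\<in>C. b c * M s c))"
    by (simp add: sum_distrib_left sum.swap[of _ S C] mult.left_commute)
  also have "\<dots> = a r * (\<Sum>c\<in>C. b c * M r c)"
    using zero r assms(2) by (subst sum.remove[of S r]) auto
  finally have "(\<Sum>c\<in>C. b c * M r c) = 0"
    using r by simp
  then have "\<forall>s\<in>S. (\<Sum>c\<in>C. b c * M s c) = 0"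
    using zero by blast
  then show False
    using assms(1) b unfolding independent_rows_def by blast
qed

text \<open>
  By maximality every row outside the basis \<open>B\<close> is a linear combination of the rows in \<open>B\<close>, so a
  combination of columns that vanishes on \<open>B\<close> vanishes everywhere.
\<close>

lemma basis_rows_detect_column_relations:
  assumes basis: "basis_of {S. S \<subseteq> G \<and> independent_rows M C S} B"
    and "finite G" "finite C"
    and vanish: "\<And>r. r \<in> B \<Longrightarrow> (\<Sum>c\<in>C. b c * M r c) = 0"
    and "g \<in> G"
  shows "(\<Sum>c\<in>C. b c * M g c) = 0"
proof (cases "g \<in> B")
  case False
  have B: "B \<subseteq> G" "independent_rows M C B" "finite B"
    using basis \<open>finite G\<close> by (auto simp: basis_of_def intro: finite_subset)
  have "\<not> independent_rows M C (insert g B)"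
    using basis False B \<open>g \<in> G\<close> unfolding basis_of_def by blast
  then obtain a where rel: "\<And>c. c \<in> C \<Longrightarrow> (\<Sum>r\<in>insert g B. a r * M r c) = 0"
    and "\<exists>r\<in>insert g B. a r \<noteq> 0"
    unfolding independent_rows_def by blast
  have "a g \<noteq> 0"
  proof
    assume "a g = 0"
    then have "\<forall>c\<in>C. (\<Sum>r\<in>B. a r * M r c) = 0"
      using rel False B(3) by simp
    then have "\<forall>r\<in>B. a r = 0"
      using B(2) unfolding independent_rows_def by blast
    then show False
      using \<open>a g = 0\<close> \<open>\<exists>r\<in>insert g B. a r \<noteq> 0\<close> by blast
  qed
  have "0 = (\<Sum>c\<in>C. b c * (\<Sum>r\<in>insert g B. a r * M r c))"
    using rel by simp
  also have "\<dots> = (\<Sum>r\<in>insert g B. a r * (\<Sum>c\<in>C. b c * M r c))"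
    by (simp only: sum_distrib_left sum.swap[of _ "insert g B" C] mult.left_commute)
  also have "\<dots> = a g * (\<Sum>c\<in>C. b c * M g c)"
    using vanish False B(3) by simp
  finally show ?thesis
    using \<open>a g \<noteq> 0\<close> by simp
qed (use vanish in simp)

text \<open>
  Maximality is a count: an independent set of rows has at most as many elements as there are
  columns.
\<close>

lemma square_nonsingular_basis:
  assumes col: "independent_rows (\<lambda>c r. M r c) S C" and "S \<subseteq> G" "finite G" "finite C"
    and card: "card S = card C"
  shows "basis_of {S. S \<subseteq> G \<and> independent_rows M C S} S"
proof -
  have "finite S"
    using assms finite_subset by blast
  then have "independent_rows M C S"
    using independent_rows_transpose_square[OF col] assms by blast
  moreover have "T = S" if "T \<subseteq> G" "independent_rows M C T" "S \<subseteq> T" for T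
    using independent_rows_card_le[OF that(2)] that assms
    by (metis card_seteq finite_subset)
  ultimately show ?thesis
    using \<open>S \<subseteq> G\<close> by (auto simp: basis_of_def)
qed


section \<open>Exterior products in coordinates\<close>

text \<open>
  The right multiplication by a vector in the exterior algebra: elements are given by their
  coordinates with respect to the products of the unit vectors over finite sets, taken in increasing
  order. The sign counts the factors that the new one has to pass to reach its place.
\<close>

definition wedge :: "(nat set \<Rightarrow> real) \<Rightarrow> (nat \<Rightarrow> real) \<Rightarrow> nat set \<Rightarrow> real" where
  "wedge x v F = (\<Sum>i\<in>F. (-1) ^ card {j\<in>F. i < j} * v i * x (F - {i}))"

definition wedge_list :: "(nat \<Rightarrow> real) list \<Rightarrow> nat set \<Rightarrow> real" where
  "wedge_list vs = foldl wedge (\<lambda>F. if F = {} then 1 else 0) vs"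

lemma wedge_sum_left:
  "wedge (\<lambda>F. \<Sum>s\<in>I. c s * x s F) v F = (\<Sum>s\<in>I. c s * wedge (x s) v F)"
  unfolding wedge_def
  by (simp add: sum_distrib_left sum.swap[of _ I F] mult.left_commute)

lemma wedge_sum_right:
  "wedge x (\<lambda>i. \<Sum>s\<in>I. c s * v s i) F = (\<Sum>s\<in>I. c s * wedge x (v s) F)"
  unfolding wedge_def
  by (simp add: sum_distrib_left sum_distrib_right sum.swap[of _ I F] mult.assoc mult.left_commute)

lemma wedge_add_right:
  "wedge x (\<lambda>i. v i + t * w i) F = wedge x v F + t * wedge x w F"
  unfolding wedge_def
  by (simp add: sum_distrib_left sum.distrib algebra_simps)

lemma wedge_scale_left: "wedge (\<lambda>F. s * x F) v = (\<lambda>F. s * wedge x v F)"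
  unfolding wedge_def by (auto simp: sum_distrib_left mult.left_commute intro!: ext sum.cong)

text \<open>
  Both sides run over ordered pairs of distinct elements of \<open>F\<close>. Exchanging the order in which two
  elements are removed changes exactly one of the two counts, namely that of the smaller element,
  and changes it by one.
\<close>

lemma wedge_anticommute: "wedge (wedge x v) w = (\<lambda>F. - wedge (wedge x w) v F)"
proof
  fix F :: "nat set"
  show "wedge (wedge x v) w F = - wedge (wedge x w) v F"
  proof (cases "finite F")
    case True
    define s :: "nat \<Rightarrow> nat \<Rightarrow> real" where
      "s i j = (-1) ^ card {k\<in>F. i < k} * (-1) ^ card {k\<in>F - {i}. j < k}" for i j
    have expand: "wedge (wedge x v) w F =
        (\<Sum>(i, j)\<in>Sigma F (\<lambda>i. F - {i}). s i j * (w i * v j * x (F - {i} - {j})))" for v w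
      using True unfolding wedge_def s_def
      by (simp add: sum.Sigma[symmetric] sum_distrib_left mult_ac)
    have bij: "bij_betw prod.swap (Sigma F (\<lambda>i. F - {i})) (Sigma F (\<lambda>i. F - {i}))"
      by (intro bij_betwI[where g = prod.swap]) auto
    have less: "s i j = - s j i" if "i \<in> F" "j \<in> F" "i < j" for i j
    proof -
      have "{k\<in>F. i < k} = insert j {k\<in>F - {j}. i < k}" "{k\<in>F. j < k} = {k\<in>F - {i}. j < k}"
        using that by auto
      then show ?thesis
        using True by (simp add: s_def)
    qed
    have anti: "s i j = - s j i" if "i \<in> F" "j \<in> F" "i \<noteq> j" for i j
      using less[of i j] less[of j i] that by (cases "i < j") auto
    have "wedge (wedge x v) w F =
        (\<Sum>(j, i)\<in>Sigma F (\<lambda>i. F - {i}). s i j * (w i * v j * x (F - {i} - {j})))"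
      unfolding expand
      by (subst sum.reindex_bij_betw[OF bij, symmetric]) (simp add: case_prod_unfold)
    also have "\<dots> = (\<Sum>(j, i)\<in>Sigma F (\<lambda>i. F - {i}). - (s j i * (v j * w i * x (F - {j} - {i}))))"
    proof -
      have "s i j * (w i * v j * x (F - {i} - {j})) = - (s j i * (v j * w i * x (F - {j} - {i})))"
        if "j \<in> F" "i \<in> F" "i \<noteq> j" for i j
      proof -
        have "F - {i} - {j} = F - {j} - {i}"
          by blast
        then show ?thesis
          using anti[of i j] that by simp
      qed
      then show ?thesis
        by (intro sum.cong) auto
    qed
    also have "\<dots> = - wedge (wedge x w) v F"
      unfolding expand by (simp add: sum_negf case_prod_unfold)
    finally show ?thesis .
  qed (simp add: wedge_def)
qed

lemma wedge_square: "wedge (wedge x v) v = (\<lambda>F. 0)"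
proof
  show "wedge (wedge x v) v F = 0" for F
    using fun_cong[OF wedge_anticommute[of x v v], of F] by simp
qed

lemma wedge_list_Nil: "wedge_list [] = (\<lambda>F. if F = {} then 1 else 0)"
  by (simp add: wedge_list_def)

lemma wedge_list_snoc: "wedge_list (vs @ [v]) = wedge (wedge_list vs) v"
  by (simp add: wedge_list_def)

lemma wedge_list_move_last:
  "wedge_list (us @ v # vs) = (\<lambda>F. (-1) ^ length vs * wedge (wedge_list (us @ vs)) v F)"
proof (induction vs rule: rev_induct)
  case Nil
  then show ?case
    by (simp add: wedge_list_snoc)
next
  case (snoc w ws)
  have "wedge_list (us @ v # ws @ [w]) = wedge (wedge_list (us @ v # ws)) w"
    using wedge_list_snoc[of "us @ v # ws" w] by simp
  also have "\<dots> = (\<lambda>F. (-1) ^ length ws * wedge (wedge (wedge_list (us @ ws)) v) w F)"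
    by (simp add: snoc.IH wedge_scale_left)
  also have "\<dots> = (\<lambda>F. (-1) ^ length (ws @ [w]) * wedge (wedge_list (us @ ws @ [w])) v F)"
    using wedge_list_snoc[of "us @ ws" w] by (subst wedge_anticommute) simp
  finally show ?case .
qed

lemma wedge_list_repeated: "wedge (wedge_list (us @ v # vs)) v = (\<lambda>F. 0)"
  by (simp add: wedge_list_move_last wedge_scale_left wedge_square)

lemma sorted_nth_greater:
  fixes F :: "nat set"
  assumes "finite F" "c < card F"
  shows "card {j\<in>F. sorted_list_of_set F ! c < j} = card F - Suc c"
proof -
  let ?l = "sorted_list_of_set F"
  have nth: "?l ! a < ?l ! b \<longleftrightarrow> a < b" if "a < card F" "b < card F" for a b
    using that sorted_wrt_nth_less[OF strict_sorted_list_of_set, of a b F]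
      sorted_wrt_nth_less[OF strict_sorted_list_of_set, of b a F]
    by (metis linorder_neqE_nat order_less_asym length_sorted_list_of_set order_less_irrefl)
  have "{j\<in>F. ?l ! c < j} = (!) ?l ` {Suc c..<card F}"
  proof (rule Set.set_eqI)
    fix j
    have "j \<in> F \<longleftrightarrow> (\<exists>b<card F. ?l ! b = j)"
      using assms by (metis in_set_conv_nth length_sorted_list_of_set set_sorted_list_of_set)
    then show "j \<in> {j\<in>F. ?l ! c < j} \<longleftrightarrow> j \<in> (!) ?l ` {Suc c..<card F}"
      using nth assms by (auto simp: image_iff Suc_le_eq)
  qed
  moreover have "inj_on ((!) ?l) {Suc c..<card F}"
    using assms by (auto intro!: inj_on_nth)
  ultimately show ?thesis
    by (simp add: card_image)
qed

lemma sorted_list_of_set_remove_nth: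
  fixes F :: "nat set"
  assumes "finite F" "c < card F" and b: "b < card F - 1"
  shows "sorted_list_of_set (F - {sorted_list_of_set F ! c}) ! b =
    (if b < c then sorted_list_of_set F ! b else sorted_list_of_set F ! Suc b)"
proof -
  let ?l = "sorted_list_of_set F"
  have "sorted_list_of_set (F - {?l ! c}) = take c ?l @ drop (Suc c) ?l"
  proof (rule sorted_list_of_set_unique[THEN iffD1])
    show "finite (F - {?l ! c})"
      using assms by simp
    have "?l ! c \<in> F"
      using assms by (metis length_sorted_list_of_set nth_mem set_sorted_list_of_set)
    then have card: "card (F - {?l ! c}) = card F - 1"
      using assms by simp
    have eq: "?l = take c ?l @ ?l ! c # drop (Suc c) ?l"
      using assms by (simp add: id_take_nth_drop)
    have "sorted_wrt (<) (take c ?l @ ?l ! c # drop (Suc c) ?l)"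
      "distinct (take c ?l @ ?l ! c # drop (Suc c) ?l)"
      "set (take c ?l @ ?l ! c # drop (Suc c) ?l) = F"
      using assms eq by (metis strict_sorted_list_of_set, metis distinct_sorted_list_of_set,
          metis set_sorted_list_of_set)
    then show "sorted_wrt (<) (take c ?l @ drop (Suc c) ?l) \<and>
        set (take c ?l @ drop (Suc c) ?l) = F - {?l ! c} \<and>
        length (take c ?l @ drop (Suc c) ?l) = card (F - {?l ! c})"
      using assms card by (auto simp: sorted_wrt_append)
  qed
  then show ?thesis
    using assms by (auto simp: nth_append)
qed

text \<open>
  The definition of \<open>wedge\<close> is the Laplace expansion along the last row.
\<close>

lemma wedge_list_eq_det:
  assumes "finite F" "card F = length vs"
  shows "wedge_list vs F = Determinant.det (Matrix.mat (length vs) (length vs)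
           (\<lambda>(r, c). (vs ! r) (sorted_list_of_set F ! c)))"
  using assms
proof (induction vs arbitrary: F rule: rev_induct)
  case Nil
  then show ?case
    by (simp add: wedge_list_Nil)
next
  case (snoc v vs)
  let ?m = "length vs" and ?l = "sorted_list_of_set F"
  let ?A = "Matrix.mat (Suc ?m) (Suc ?m) (\<lambda>(r, c). ((vs @ [v]) ! r) (?l ! c))"
  have card: "card F = Suc ?m"
    using snoc.prems by simp
  have bij: "bij_betw ((!) ?l) {..<Suc ?m} F"
    using snoc.prems card by (intro bij_betw_nth) auto
  have term_eq: "(-1) ^ card {j\<in>F. ?l ! c < j} * v (?l ! c) * wedge_list vs (F - {?l ! c}) =
      ?A $$ (?m, c) * cofactor ?A ?m c" if c: "c < Suc ?m" for c
  proof -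
    have memb: "?l ! c \<in> F"
      using bij c by (auto simp: bij_betw_def)
    have "wedge_list vs (F - {?l ! c}) = Determinant.det (Matrix.mat ?m ?m
           (\<lambda>(r, b). (vs ! r) (sorted_list_of_set (F - {?l ! c}) ! b)))"
      using snoc.IH[of "F - {?l ! c}"] memb card snoc.prems by simp
    also have "Matrix.mat ?m ?m (\<lambda>(r, b). (vs ! r) (sorted_list_of_set (F - {?l ! c}) ! b)) =
        mat_delete ?A ?m c"
      using c card snoc.prems
      by (intro eq_matI) (auto simp: mat_delete_def sorted_list_of_set_remove_nth nth_append)
    finally have "wedge_list vs (F - {?l ! c}) = Determinant.det (mat_delete ?A ?m c)" .
    moreover have "card {j\<in>F. ?l ! c < j} = ?m - c"
      using sorted_nth_greater[of F c] snoc.prems card c by simp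
    moreover have "(-1::real) ^ (?m - c) = (-1) ^ (?m + c)"
      using c by (simp add: minus_one_power_iff)
    ultimately show ?thesis
      using c by (simp add: cofactor_def nth_append)
  qed
  have "wedge_list (vs @ [v]) F = (\<Sum>i\<in>F. (-1) ^ card {j\<in>F. i < j} * v i * wedge_list vs (F - {i}))"
    by (simp add: wedge_list_snoc wedge_def)
  also have "\<dots> = (\<Sum>c<Suc ?m. ?A $$ (?m, c) * cofactor ?A ?m c)"
    by (subst sum.reindex_bij_betw[OF bij, symmetric]) (intro sum.cong refl, use term_eq in auto)
  also have "\<dots> = Determinant.det ?A"
    by (rule laplace_expansion_row[symmetric]) auto
  finally show ?case
    by simp
qed

text \<open>
  The exterior monomials in a family of vectors.
\<close>

definition wedge_set :: "(nat \<Rightarrow> nat \<Rightarrow> real) \<Rightarrow> nat set \<Rightarrow> nat set \<Rightarrow> real" where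
  "wedge_set g S = wedge_list (map g (sorted_list_of_set S))"

lemma insort_split: "\<exists>us vs. xs = us @ vs \<and> insort j xs = us @ j # vs"
proof (induction xs)
  case (Cons a xs)
  obtain us vs where "xs = us @ vs" "insort j xs = us @ j # vs"
    using Cons.IH by blast
  show ?case
  proof (cases "j \<le> a")
    case True
    then show ?thesis
      by (intro exI[of _ "[]"] exI[of _ "a # xs"]) simp
  next
    case False
    then show ?thesis
      using \<open>xs = us @ vs\<close> \<open>insort j xs = us @ j # vs\<close>
      by (intro exI[of _ "a # us"] exI[of _ vs]) simp
  qed
qed simp

lemma sorted_list_of_set_insert_split:
  fixes S :: "nat set"
  assumes "finite S" "j \<notin> S"
  obtains us vs where "sorted_list_of_set S = us @ vs"
    "sorted_list_of_set (insert j S) = us @ j # vs" "set us \<union> set vs = S"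
proof -
  obtain us vs where "sorted_list_of_set S = us @ vs" "insort j (sorted_list_of_set S) = us @ j # vs"
    using insort_split by blast
  moreover from this have "set us \<union> set vs = S"
    using assms by (metis set_append set_sorted_list_of_set)
  ultimately show ?thesis
    using assms that by (simp add: sorted_list_of_set_insert)
qed

lemma wedge_set_repeated:
  assumes "finite S" "j \<in> S"
  shows "wedge (wedge_set g S) (g j) F = 0"
proof -
  obtain us vs where "sorted_list_of_set S = us @ j # vs"
    using assms by (metis split_list set_sorted_list_of_set)
  then show ?thesis
    by (simp add: wedge_set_def wedge_list_repeated)
qed

text \<open>
  The factor \<open>s\<close> is a sign; later arguments only use that it is nonzero and that it is the same for
  all coordinates.
\<close>

lemma wedge_set_insert:
  assumes "finite S" "j \<notin> S"
  obtains s where "s \<noteq> 0"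
    "\<And>F. wedge (wedge_set g S) (g j) F = s * wedge_set g (insert j S) F"
proof -
  obtain us vs where "sorted_list_of_set S = us @ vs" "sorted_list_of_set (insert j S) = us @ j # vs"
    using sorted_list_of_set_insert_split[OF assms] by blast
  then have "wedge (wedge_set g S) (g j) F = (-1) ^ length vs * wedge_set g (insert j S) F" for F
    by (cases "even (length vs)") (simp_all add: wedge_set_def wedge_list_move_last)
  then show ?thesis
    by (rule that[rotated]) simp
qed

lemma wedge_set_insert_greater:
  assumes "finite S" "\<And>i. i \<in> S \<Longrightarrow> i < m"
  shows "wedge_set g (insert m S) = wedge (wedge_set g S) (g m)"
proof -
  have "sorted_list_of_set (insert m S) = sorted_list_of_set S @ [m]"
    using assms sorted_insort_is_snoc[of "sorted_list_of_set S" m]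
    by (subst sorted_list_of_set_insert) (auto intro: less_imp_le)
  then show ?thesis
    by (simp add: wedge_set_def wedge_list_snoc)
qed

abbreviation unit_vector :: "nat \<Rightarrow> nat \<Rightarrow> real" where
  "unit_vector m \<equiv> (\<lambda>i. if i = m then 1 else 0)"

lemma wedge_unit_vector:
  assumes "finite F"
  shows "wedge x (unit_vector m) F =
    (if m \<in> F then (-1) ^ card {j\<in>F. m < j} * x (F - {m}) else 0)"
proof -
  have "wedge x (unit_vector m) F =
      (\<Sum>i\<in>F. if i = m then (-1) ^ card {j\<in>F. m < j} * x (F - {m}) else 0)"
    unfolding wedge_def by (intro sum.cong) auto
  then show ?thesis
    using assms by simp
qed

lemma wedge_eq_sum_unit_vectors:
  assumes "finite V" "F \<subseteq> V"
  shows "wedge x v F = (\<Sum>i\<in>V. v i * wedge x (unit_vector i) F)"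
proof -
  have "wedge x v F = wedge x (\<lambda>j. \<Sum>i\<in>V. v i * unit_vector i j) F"
    unfolding wedge_def
  proof (intro sum.cong refl)
    fix j assume "j \<in> F"
    then have "(\<Sum>i\<in>V. v i * unit_vector i j) = v j"
      using assms by (subst sum.remove[of V j]) (auto intro!: sum.neutral)
    then show "(-1) ^ card {k\<in>F. j < k} * v j * x (F - {j}) =
        (-1) ^ card {k\<in>F. j < k} * (\<Sum>i\<in>V. v i * unit_vector i j) * x (F - {j})"
      by simp
  qed
  then show ?thesis
    by (simp add: wedge_sum_right)
qed


section \<open>The rigidity matrix as a matrix of exterior products\<close>

text \<open>
  Together these vectors are a basis of the space of functions on \<open>{1..n}\<close> when the first \<open>d + 1\<close>
  points are affinely independent. The first \<open>d + 1\<close> of them are the rows of the volume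
  determinant; the unit vectors complete them and allow evaluating products by deleting an element.
\<close>

definition frame :: "nat \<Rightarrow> config \<Rightarrow> nat \<Rightarrow> nat \<Rightarrow> real" where
  "frame d p i = (if i = 1 then (\<lambda>v. 1) else if i \<le> d + 1 then (\<lambda>v. p v (i - 1)) else unit_vector i)"

lemma sorted_list_of_set_1_upto: "sorted_list_of_set {1..d + 1} = [1..<d + 2]"
  using sorted_list_of_set_range[of 1 "d + 2"]
  by (metis Suc_eq_plus1 add_2_eq_Suc' atLeastLessThanSuc_atLeastAtMost)

lemma volume_map_eq_wedge_set:
  assumes "card \<sigma> = d + 1"
  shows "volume_map d p \<sigma> = wedge_set (frame d p) {1..d + 1} \<sigma>"
proof -
  let ?vs = "map (frame d p) [1..<d + 2]"
  have "finite \<sigma>"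
    using assms by (simp add: card_ge_0_finite)
  then have "wedge_list ?vs \<sigma> = Determinant.det (Matrix.mat (length ?vs) (length ?vs)
           (\<lambda>(r, c). (?vs ! r) (sorted_list_of_set \<sigma> ! c)))"
    using assms by (intro wedge_list_eq_det) auto
  also have "Matrix.mat (length ?vs) (length ?vs) (\<lambda>(r, c). (?vs ! r) (sorted_list_of_set \<sigma> ! c)) =
      Matrix.mat (d + 1) (d + 1)
       (\<lambda>(r, c). if r = 0 then 1 else p (sorted_list_of_set \<sigma> ! c) r)"
    by (intro eq_matI) (auto simp: frame_def simp del: upt_Suc)
  finally show ?thesis
    unfolding volume_map_def wedge_set_def sorted_list_of_set_1_upto by simp
qed

text \<open>
  The volume is an affine function of a single coordinate \<open>p i j\<close>: changing it adds a multiple of a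
  unit vector to the factor \<open>frame d p (j + 1)\<close>. The nonzero factor is a sign that depends only on the
  column index \<open>j\<close>, so it does not affect relations among rows.
\<close>

lemma rigidity_matrix_eq_wedge:
  assumes j: "j \<in> {1..d}"
  obtains s where "s \<noteq> 0"
    "\<And>\<sigma> i. card \<sigma> = d + 1 \<Longrightarrow> rigidity_matrix d p \<sigma> (i, j) =
        s * wedge (wedge_set (frame d p) ({1..d + 1} - {j + 1})) (unit_vector i) \<sigma>"
proof -
  let ?D = "{1..d + 1}"
  have D: "insert (j + 1) (?D - {j + 1}) = ?D"
    using j by auto
  obtain us vs where uv: "sorted_list_of_set (?D - {j + 1}) = us @ vs"
    "sorted_list_of_set ?D = us @ (j + 1) # vs" "set us \<union> set vs = ?D - {j + 1}"
    using sorted_list_of_set_insert_split[of "?D - {j + 1}" "j + 1"] unfolding D by blast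
  define s :: real where "s = (-1) ^ length vs"
  define x where "x = wedge_set (frame d p) (?D - {j + 1})"
  have "rigidity_matrix d p \<sigma> (i, j) = s * wedge x (unit_vector i) \<sigma>"
    if card: "card \<sigma> = d + 1" for \<sigma> i
  proof -
    have "volume_map d (p(i := (p i)(j := t))) \<sigma> =
        s * (wedge x (frame d p (j + 1)) \<sigma> + (t - p i j) * wedge x (unit_vector i) \<sigma>)" for t
    proof -
      let ?q = "p(i := (p i)(j := t))"
      have rest: "frame d ?q l = frame d p l" if "l \<in> ?D - {j + 1}" for l
        using that j by (auto simp: frame_def fun_eq_iff)
      have row: "frame d ?q (j + 1) = (\<lambda>v. frame d p (j + 1) v + (t - p i j) * unit_vector i v)"
        using j by (auto simp: frame_def fun_eq_iff)
      have "map (frame d ?q) us = map (frame d p) us" "map (frame d ?q) vs = map (frame d p) vs"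
        using rest unfolding uv(3)[symmetric] by simp_all
      then have "wedge_set (frame d ?q) ?D =
          wedge_list (map (frame d p) us @ frame d ?q (j + 1) # map (frame d p) vs)"
        unfolding wedge_set_def uv(2) by (simp only: list.map map_append)
      also have "\<dots> = (\<lambda>F. s * wedge x (frame d ?q (j + 1)) F)"
        unfolding wedge_list_move_last s_def x_def wedge_set_def uv(1) by simp
      finally show ?thesis
        using card unfolding row by (simp add: volume_map_eq_wedge_set wedge_add_right)
    qed
    moreover have "((\<lambda>t. s * (wedge x (frame d p (j + 1)) \<sigma> + (t - p i j) * wedge x (unit_vector i) \<sigma>))
        has_real_derivative s * wedge x (unit_vector i) \<sigma>) (at (p i j))"
      by (auto intro!: derivative_eq_intros)
    ultimately show ?thesis
      by (simp add: rigidity_matrix_def DERIV_imp_deriv)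
  qed
  moreover have "s \<noteq> 0"
    by (simp add: s_def)
  ultimately show ?thesis
    using that x_def by blast
qed

lemma frame_nonsingular:
  assumes vol: "volume_map d p {1..d + 1} \<noteq> 0"
    and zero: "\<And>l. l \<in> {1..d + 1} \<Longrightarrow> (\<Sum>i\<in>{1..d + 1}. frame d p l i * z i) = 0"
    and i: "i \<in> {1..d + 1}"
  shows "z i = 0"
proof -
  define A where "A = Matrix.mat (d + 1) (d + 1)
       (\<lambda>(r, c). if r = 0 then 1 else p (sorted_list_of_set {1..d + 1} ! c) r)"
  define u where "u = Matrix.vec (d + 1) (\<lambda>c. z (c + 1))"
  have A: "A \<in> carrier_mat (d + 1) (d + 1)" and u: "u \<in> carrier_vec (d + 1)"
    by (simp_all add: A_def u_def)
  have entry: "A $$ (r, c) = frame d p (r + 1) (c + 1)" if "r < d + 1" "c < d + 1" for r c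
    using that unfolding A_def sorted_list_of_set_1_upto by (auto simp: frame_def simp del: upt_Suc)
  have bij: "bij_betw Suc {0..<d + 1} {1..d + 1}"
    by (rule bij_betwI[where g = "\<lambda>i. i - 1"]) auto
  have "A *\<^sub>v u = 0\<^sub>v (d + 1)"
  proof (rule eq_vecI)
    fix r assume "r < dim_vec (0\<^sub>v (d + 1) :: real Matrix.vec)"
    then have r: "r < d + 1"
      by simp
    have "(A *\<^sub>v u) $ r = (\<Sum>c\<in>{0..<d + 1}. A $$ (r, c) * z (c + 1))"
      using r A by (simp add: u_def scalar_prod_def)
    also have "\<dots> = (\<Sum>c\<in>{0..<d + 1}. frame d p (r + 1) (Suc c) * z (Suc c))"
      using entry r by (intro sum.cong) auto
    also have "\<dots> = (\<Sum>i\<in>{1..d + 1}. frame d p (r + 1) i * z i)"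
      by (rule sum.reindex_bij_betw[OF bij])
    also have "\<dots> = 0"
      using zero[of "r + 1"] r by auto
    finally show "(A *\<^sub>v u) $ r = 0\<^sub>v (d + 1) $ r"
      using r by simp
  qed (use A in simp)
  moreover have "Determinant.det A \<noteq> 0"
    using vol unfolding volume_map_def A_def .
  ultimately have "u = 0\<^sub>v (d + 1)"
    using det_0_iff_vec_prod_zero_field[OF A] u by blast
  then have "u $ (i - 1) = 0"
    using i by auto
  then show ?thesis
    using i by (auto simp: u_def)
qed

section \<open>The shifted complex and its face numbers\<close>

text \<open>
  The facets are \<open>{1..d + 1}\<close> and the sets obtained from it by exchanging an element other than 1 for
  a vertex above \<open>d + 1\<close>. In the componentwise order of sorted sets these are the facets below
  \<open>{1, 3, \<dots>, d + 1, n}\<close> (for \<open>n > d + 1\<close>). The description by cardinalities makes closure under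
  subsets and the extension of faces immediate: the condition on 1 concerns the facets only.
\<close>

definition shifted_complex :: "nat \<Rightarrow> nat \<Rightarrow> nat set set" where
  "shifted_complex n d = {S. S \<subseteq> {1..n} \<and> card (S - {1..d + 1}) \<le> 1 \<and>
     card S \<le> d + 1 \<and> (card S = d + 1 \<longrightarrow> 1 \<in> S)}"

lemma shifted_complex_facet_cases:
  assumes "S \<in> simplices (shifted_complex n d) d"
  obtains "S = {1..d + 1}"
  | j m where "j \<in> {2..d + 1}" "m \<in> {d + 2..n}" "S = insert m ({1..d + 1} - {j})"
proof -
  have S: "S \<subseteq> {1..n}" "card (S - {1..d + 1}) \<le> 1" "card S = d + 1" "1 \<in> S"
    using assms by (auto simp: simplices_def shifted_complex_def)
  have "finite S"
    using S(1) finite_subset by blast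
  show ?thesis
  proof (cases "S \<subseteq> {1..d + 1}")
    case True
    then show ?thesis
      using S that(1) card_subset_eq[of "{1..d + 1}" S] by simp
  next
    case False
    then obtain m where m: "m \<in> S" "m \<notin> {1..d + 1}"
      by blast
    then have "card (S - {1..d + 1}) = 1"
      using S(2) \<open>finite S\<close> by (metis DiffI One_nat_def card_eq_0_iff empty_iff finite_Diff le_Suc_eq le_zero_eq)
    then have outside: "S - {1..d + 1} = {m}"
      using m by (metis DiffI card_1_singletonE singletonD)
    then have eq: "S = insert m (S \<inter> {1..d + 1})"
      by blast
    then have "card (S \<inter> {1..d + 1}) = d"
      using S(3) m \<open>finite S\<close> by (metis Int_iff card_insert_disjoint diff_Suc_1 finite_Int Suc_eq_plus1)
    moreover have "card ({1..d + 1} - S) = d + 1 - card (S \<inter> {1..d + 1})"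
      using card_Diff_subset_Int[of "{1..d + 1}" S] by (simp add: Int_commute)
    ultimately obtain j where j: "{1..d + 1} - S = {j}"
      by (metis add_diff_cancel_left' card_1_singletonE)
    then have "j \<in> {1..d + 1}" "j \<noteq> 1"
      using S(4) by blast+
    moreover have "S = insert m ({1..d + 1} - {j})"
      using eq j by blast
    moreover have "m \<in> {d + 2..n}"
      using m S(1) by auto
    ultimately show ?thesis
      using that(2)[of j m] by auto
  qed
qed

lemma standard_facet:
  assumes "d + 1 \<le> n"
  shows "{1..d + 1} \<in> simplices (shifted_complex n d) d"
proof -
  have "{1..d + 1} \<subseteq> {1..n}" "{1..d + 1} - {1..d + 1} = ({} :: nat set)" "card {1..d + 1} = d + 1"
    "1 \<in> {1..d + 1}"
    using assms by auto
  then show ?thesis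
    unfolding simplices_def shifted_complex_def mem_Collect_eq by (metis card.empty le_refl zero_le)
qed

lemma cone_facet:
  assumes "j \<in> {2..d + 1}" "m \<in> {d + 2..n}"
  shows "insert m ({1..d + 1} - {j}) \<in> simplices (shifted_complex n d) d"
proof -
  let ?S = "insert m ({1..d + 1} - {j})"
  have "?S - {1..d + 1} = {m}" "?S \<subseteq> {1..n}" "1 \<in> ?S"
    using assms by auto
  moreover have "card ?S = d + 1"
  proof -
    have "card ({1..d + 1} - {j}) = d" "m \<notin> {1..d + 1} - {j}"
      using assms by simp_all
    then show ?thesis
      by simp
  qed
  ultimately show ?thesis
    unfolding simplices_def shifted_complex_def mem_Collect_eq by simp
qed

lemma simplices_shifted_complex_subset_ground_set:
  "simplices (shifted_complex n d) d \<subseteq> ground_set n d"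
  by (auto simp: simplices_def shifted_complex_def ground_set_def)

lemma finite_ground_set: "finite (ground_set n d)"
  by (rule finite_subset[of _ "Pow {1..n}"]) (auto simp: ground_set_def)

lemma finite_simplices_shifted_complex: "finite (simplices (shifted_complex n d) k)"
  by (rule finite_subset[of _ "Pow {1..n}"]) (auto simp: simplices_def shifted_complex_def)

lemma shifted_complex_closed:
  assumes "S \<in> shifted_complex n d" "T \<subseteq> S"
  shows "T \<in> shifted_complex n d"
proof -
  have S: "S \<subseteq> {1..n}" "card (S - {1..d + 1}) \<le> 1" "card S \<le> d + 1" "card S = d + 1 \<longrightarrow> 1 \<in> S"
    using assms(1) by (auto simp: shifted_complex_def)
  have fin: "finite S"
    using S(1) finite_subset by blast
  have "card (T - {1..d + 1}) \<le> card (S - {1..d + 1})"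
    using assms(2) fin by (intro card_mono) auto
  moreover have "card T \<le> card S"
    using assms(2) fin by (rule card_mono[rotated])
  moreover have "card T = d + 1 \<longrightarrow> T = S"
    using assms(2) fin S(3) by (metis card_seteq)
  ultimately show ?thesis
    using S assms(2) unfolding shifted_complex_def mem_Collect_eq by (metis le_trans subset_trans)
qed

text \<open>
  The condition \<open>1 \<in> S \<or> r = 1\<close> is what keeps the new set in the complex if it has \<open>d + 1\<close> elements.
\<close>

lemma shifted_complex_insert:
  assumes "S \<in> simplices (shifted_complex n d) k" "k < d" "d + 1 \<le> n"
    and r: "r \<in> {1..d + 1}" "r \<notin> S" and "1 \<in> S \<or> r = 1"
  shows "insert r S \<in> simplices (shifted_complex n d) (k + 1)"
proof -
  have S: "S \<subseteq> {1..n}" "card (S - {1..d + 1}) \<le> 1" "card S = k + 1"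
    using assms(1) by (auto simp: shifted_complex_def simplices_def)
  have "finite S"
    using S(1) finite_subset by blast
  then have "card (insert r S) = k + 2"
    using S(3) r(2) by simp
  moreover have "insert r S - {1..d + 1} = S - {1..d + 1}"
    using r(1) by blast
  moreover have "insert r S \<subseteq> {1..n}"
    using S(1) r(1) assms(3) by auto
  moreover have "1 \<in> insert r S"
    using assms(6) by blast
  ultimately show ?thesis
    using S(2) \<open>k < d\<close> unfolding simplices_def shifted_complex_def mem_Collect_eq by simp
qed

lemma simplices_shifted_complex_small:
  assumes "k \<le> d" "S \<subseteq> {1..d + 1}" "d + 1 \<le> n" "card S = k + 1"
  shows "S \<in> simplices (shifted_complex n d) k"
proof -
  have "card (S - {1..d + 1}) = 0" "S \<subseteq> {1..n}"
    using assms(2,3) by (metis Diff_eq_empty_iff card.empty) (use assms(2,3) in auto)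
  moreover have "card S = d + 1 \<longrightarrow> S = {1..d + 1}"
    using assms(2) by (metis card_atLeastAtMost card_subset_eq diff_Suc_1 Suc_eq_plus1 finite_atLeastAtMost)
  moreover have "1 \<in> {1..d + 1}"
    by simp
  ultimately show ?thesis
    using assms(1,4) unfolding simplices_def shifted_complex_def mem_Collect_eq by simp
qed

text \<open>
  For purity, a face is enlarged by 1 and then by further elements of \<open>{1..d + 1}\<close>, which adds no
  vertex above \<open>d + 1\<close>.
\<close>

lemma dim_complex_shifted_complex:
  assumes "1 \<le> d" "d + 1 \<le> n"
  shows "dim_complex n d (shifted_complex n d)"
  unfolding dim_complex_def simplicial_complex_def
proof (intro conjI ballI allI impI)
  show "T \<in> shifted_complex n d" if "S \<in> shifted_complex n d" "T \<subseteq> S" for S T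
    using shifted_complex_closed that .
  have "{m} \<in> shifted_complex n d" if "m \<in> {1..n}" for m
  proof -
    have "card ({m} - {1..d + 1}) \<le> card {m}"
      by (rule card_mono) auto
    then show ?thesis
      using that assms(1) by (simp add: shifted_complex_def)
  qed
  moreover have "S \<subseteq> {1..n}" if "S \<in> shifted_complex n d" for S
    using that by (simp add: shifted_complex_def)
  ultimately show "\<Union> (shifted_complex n d) = {1..n}"
    by blast
  show "simplices (shifted_complex n d) d \<noteq> {}"
    using standard_facet[OF assms(2)] by blast
  show "simplices (shifted_complex n d) k = {}" if "d < k" for k
    using that by (auto simp: simplices_def shifted_complex_def)
  show "\<exists>T\<in>simplices (shifted_complex n d) d. S \<subseteq> T" if S: "S \<in> shifted_complex n d" for S
  proof (cases "card S = d + 1")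
    case True
    then show ?thesis
      using S by (auto simp: simplices_def)
  next
    case False
    have S': "S \<subseteq> {1..n}" "card (S - {1..d + 1}) \<le> 1" "card S < d + 1"
      using S False by (auto simp: shifted_complex_def)
    have fin: "finite S"
      using S'(1) finite_subset by blast
    have "card (insert 1 S) \<le> d + 1"
      using S'(3) fin by (simp add: card_insert_if)
    moreover have "d + 1 \<le> card (S \<union> {1..d + 1})"
      using fin card_mono[of "S \<union> {1..d + 1}" "{1..d + 1}"] by simp
    moreover have "insert 1 S \<subseteq> S \<union> {1..d + 1}"
      by auto
    ultimately obtain T where T: "insert 1 S \<subseteq> T" "T \<subseteq> S \<union> {1..d + 1}" "card T = d + 1"
      using exists_subset_between[of "insert 1 S" "d + 1" "S \<union> {1..d + 1}"] fin by auto
    have "card (T - {1..d + 1}) \<le> card (S - {1..d + 1})"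
      using T(2) fin by (intro card_mono) auto
    moreover have "T \<subseteq> {1..n}"
      using T(2) S'(1) assms(2) by fastforce
    ultimately have "T \<in> simplices (shifted_complex n d) d"
      using T S'(2) by (auto simp: simplices_def shifted_complex_def)
    then show ?thesis
      using T(1) by blast
  qed
qed

text \<open>
  Faces are separated by whether they have a vertex \<open>m\<close> above \<open>d + 1\<close>; the rest \<open>A\<close> of such a face
  is an arbitrary \<open>k\<close>-subset of \<open>{1..d + 1}\<close>, except that \<open>{2..d + 1}\<close> is excluded.
\<close>

lemma simplices_shifted_complex_decomposition:
  assumes "k \<le> d" "d + 1 \<le> n"
  shows "simplices (shifted_complex n d) k =
    {A. A \<subseteq> {1..d + 1} \<and> card A = k + 1} \<union>
    (\<lambda>(A, m). insert m A) ` ({A. A \<subseteq> {1..d + 1} \<and> card A = k \<and> (k = d \<longrightarrow> 1 \<in> A)} \<times> {d + 2..n})"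
    (is "?L = ?X \<union> ?Y")
proof (intro subset_antisym subsetI)
  fix S assume "S \<in> ?L"
  then have S: "S \<subseteq> {1..n}" "card (S - {1..d + 1}) \<le> 1" "card S = k + 1" "k = d \<longrightarrow> 1 \<in> S"
    by (auto simp: simplices_def shifted_complex_def)
  have fin: "finite S"
    using S(1) finite_subset by blast
  show "S \<in> ?X \<union> ?Y"
  proof (cases "S \<subseteq> {1..d + 1}")
    case False
    then obtain m where m: "m \<in> S" "m \<notin> {1..d + 1}"
      by blast
    have "S - {1..d + 1} = {m}"
      using S(2) m fin card_le_Suc0_iff_eq[of "S - {1..d + 1}"] by auto
    then have "S - {m} \<subseteq> {1..d + 1}"
      by blast
    moreover have "card (S - {m}) = k"
      using S(3) m(1) by simp
    moreover have "k = d \<longrightarrow> 1 \<in> S - {m}"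
      using S(4) m(2) by auto
    moreover have "m \<in> {d + 2..n}"
      using m S(1) by auto
    moreover have "S = insert m (S - {m})"
      using m(1) by blast
    ultimately show ?thesis
      by (intro UnI2 image_eqI[of _ _ "(S - {m}, m)"]) auto
  qed (use S(3) in simp)
next
  fix S assume "S \<in> ?X \<union> ?Y"
  then show "S \<in> ?L"
  proof
    assume "S \<in> ?X"
    then show ?thesis
      using simplices_shifted_complex_small assms by blast
  next
    assume "S \<in> ?Y"
    then obtain A m where A: "A \<subseteq> {1..d + 1}" "card A = k" "k = d \<longrightarrow> 1 \<in> A"
      and m: "m \<in> {d + 2..n}" and S: "S = insert m A"
      by auto
    have "m \<notin> A" "m \<notin> {1..d + 1}"
      using A(1) m by auto
    moreover have "finite A"
      using A(1) finite_subset by blast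
    ultimately have "card S = k + 1" "S - {1..d + 1} = {m}"
      using A S by auto
    moreover have "S \<subseteq> {1..n}"
      using A(1) m S assms(2) by fastforce
    ultimately show ?thesis
      using A S assms(1) unfolding simplices_def shifted_complex_def mem_Collect_eq by auto
  qed
qed

text \<open>
  For \<open>k < d\<close> the sum in the bound is a full diagonal sum of binomial coefficients and equals the
  number \<open>(d + 1) choose k\<close> of \<open>k\<close>-subsets of \<open>{1..d + 1}\<close>. For \<open>k = d\<close> it stops one term short of
  the full diagonal, which matches the one excluded subset.
\<close>

lemma f_vec_shifted_complex:
  assumes "1 \<le> d" "d + 1 \<le> n" "k \<le> d"
  shows "f_vec (shifted_complex n d) k = face_bound n d k"
proof -
  let ?D = "{1..d + 1}"
  let ?A = "{A. A \<subseteq> ?D \<and> card A = k \<and> (k = d \<longrightarrow> 1 \<in> A)}"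
  let ?X = "{A. A \<subseteq> ?D \<and> card A = k + 1}"
  let ?Y = "(\<lambda>(A, m). insert m A) ` (?A \<times> {d + 2..n})"
  have fin: "finite ?X" "finite ?A"
    by (rule finite_subset[of _ "Pow ?D"]; auto)+
  have "?X \<inter> ?Y = {}"
    by fastforce
  have "inj_on (\<lambda>(A, m). insert m A) (?A \<times> {d + 2..n})"
  proof (rule inj_onI, clarify)
    fix A m B l
    assume AB: "A \<subseteq> ?D" "B \<subseteq> ?D" and lm: "m \<in> {d + 2..n}" "l \<in> {d + 2..n}"
      and eq: "insert m A = insert l B"
    have "m \<notin> ?D" "l \<notin> ?D"
      using lm by auto
    then have "insert m A - ?D = {m}" "insert l B - ?D = {l}" "insert m A \<inter> ?D = A" "insert l B \<inter> ?D = B"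
      using AB by blast+
    then show "A = B \<and> m = l"
      using eq by (metis singleton_inject)
  qed
  then have "card ?Y = card ?A * (n - d - 1)"
    by (simp add: card_image card_cartesian_product)
  moreover have "card ?X = (d + 1) choose (k + 1)"
    using n_subsets[of ?D "k + 1"] by simp
  moreover have "card (?X \<union> ?Y) = card ?X + card ?Y"
    using fin \<open>?X \<inter> ?Y = {}\<close> by (intro card_Un_disjoint finite_imageI finite_cartesian_product) simp_all
  ultimately have f: "f_vec (shifted_complex n d) k = ((d + 1) choose (k + 1)) + card ?A * (n - d - 1)"
    unfolding f_vec_def simplices_shifted_complex_decomposition[OF assms(3,2)] by presburger
  have "card ?A = (\<Sum>l = 0..<d. shifted_binomial d k l)"
  proof (cases "k = d")
    case True
    have "?A = (\<lambda>j. ?D - {j}) ` {2..d + 1}"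
    proof (intro subset_antisym subsetI)
      fix A assume "A \<in> ?A"
      then have A: "A \<subseteq> ?D" "card A = d" "1 \<in> A"
        using True by auto
      then have "card (?D - A) = 1"
        by (subst card_Diff_subset) (auto intro: finite_subset)
      then obtain j where j: "?D - A = {j}"
        by (rule card_1_singletonE)
      then have "j \<in> ?D" "j \<noteq> 1" "A = ?D - {j}"
        using A by blast+
      then show "A \<in> (\<lambda>j. ?D - {j}) ` {2..d + 1}"
        by (intro image_eqI[of _ _ j]) auto
    next
      fix A assume "A \<in> (\<lambda>j. ?D - {j}) ` {2..d + 1}"
      then obtain j where "j \<in> {2..d + 1}" "A = ?D - {j}"
        by blast
      then show "A \<in> ?A"
        using True by auto
    qed
    moreover have "inj_on (\<lambda>j. ?D - {j}) {2..d + 1}"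
    proof (rule inj_onI)
      fix i j assume "i \<in> {2..d + 1}" "j \<in> {2..d + 1}" "?D - {i} = ?D - {j}"
      moreover from this have "i \<in> ?D"
        by auto
      ultimately show "i = j"
        by blast
    qed
    ultimately have "card ?A = d"
      by (simp add: card_image)
    moreover have "(\<Sum>l = 0..<d. shifted_binomial d k l) = (\<Sum>l = 0..<d. 1)"
      using True by (intro sum.cong) (auto simp: shifted_binomial_def)
    ultimately show ?thesis
      by simp
  next
    case False
    then have "k < d"
      using assms(3) by simp
    have "(\<Sum>l = 0..<d. shifted_binomial d k l) = (\<Sum>l\<le>k. shifted_binomial d k l)"
      using \<open>k < d\<close> by (intro sum.mono_neutral_right) (auto simp: shifted_binomial_def)
    also have "\<dots> = (\<Sum>l\<le>k. (d - l) choose (k - l))"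
      by (intro sum.cong) (auto simp: shifted_binomial_def)
    also have "\<dots> = (d + 1) choose k"
      using sum_choose_diagonal[OF assms(3)] by simp
    finally show ?thesis
      using n_subsets[of ?D k] False by simp
  qed
  then show ?thesis
    unfolding f face_bound_def by (simp add: sum_distrib_left mult.commute)
qed


section \<open>The matroid and the facets of the shifted complex\<close>

lemma insert_Diff_singleton_inject:
  assumes "m \<notin> D" "i \<in> D" "insert m (D - {i}) = insert m (D - {j})"
  shows "i = j"
proof (rule ccontr)
  assume "i \<noteq> j"
  then have "i \<in> insert m (D - {j})"
    using assms(2) by blast
  then have "i \<in> insert m (D - {i})"
    using assms(3) by simp
  then show False
    using assms(1,2) by blast
qed

text \<open>
  Evaluating a relation at \<open>D = {1..d + 1}\<close> isolates the coefficient of \<open>D\<close>, since the products for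
  the other facets contain a unit vector outside \<open>D\<close>. Evaluating at \<open>D - {i} \<union> {m}\<close> isolates the
  facets through \<open>m\<close> and says that a combination \<open>u\<close> of the products over \<open>D - {j}\<close> vanishes at
  \<open>D - {i}\<close> for all \<open>i \<noteq> 1\<close>. Every term of \<open>u\<close> contains the all-ones vector, so multiplying \<open>u\<close> by
  it gives zero, and this forces \<open>u\<close> to vanish at \<open>D - {1}\<close> as well. Multiplying \<open>u\<close> by the
  \<open>j\<close>-th frame vector then shows that the coefficient belonging to \<open>j\<close> is zero.
\<close>

lemma facet_wedges_independent:
  assumes "d \<ge> 1" "d + 1 \<le> n" and vol: "volume_map d p {1..d + 1} \<noteq> 0"
  shows "independent_rows (wedge_set (frame d p))
    (simplices (shifted_complex n d) d) (simplices (shifted_complex n d) d)"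
  unfolding independent_rows_def
proof (intro allI impI)
  let ?D = "{1..d + 1}" and ?C = "simplices (shifted_complex n d) d" and ?w = "wedge_set (frame d p)"
  fix a
  assume rel: "\<forall>\<sigma>\<in>?C. (\<Sum>S\<in>?C. a S * ?w S \<sigma>) = 0"
  have fin: "finite ?C"
    by (rule finite_simplices_shifted_complex)
  have det: "?w ?D ?D \<noteq> 0"
    using vol volume_map_eq_wedge_set[of ?D d p] by auto
  have cone: "?w (insert m (?D - {j})) \<sigma> =
      (if m \<in> \<sigma> then (-1) ^ card {k\<in>\<sigma>. m < k} * ?w (?D - {j}) (\<sigma> - {m}) else 0)"
    if "m \<in> {d + 2..n}" "finite \<sigma>" for j m \<sigma>
  proof -
    have "?w (insert m (?D - {j})) = wedge (?w (?D - {j})) (frame d p m)"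
      using that by (intro wedge_set_insert_greater) auto
    moreover have "frame d p m = unit_vector m"
      using that by (auto simp: frame_def)
    ultimately show ?thesis
      using wedge_unit_vector[OF that(2)] by simp
  qed
  have zero_std: "a ?D = 0"
  proof -
    have "?w S ?D = 0" if S: "S \<in> ?C" and ne: "S \<noteq> ?D" for S
      using S
    proof (cases rule: shifted_complex_facet_cases)
      case (2 j m)
      then have "m \<notin> ?D"
        by auto
      then show ?thesis
        using cone[of m ?D j] 2 by simp
    qed (use ne in simp)
    then have "(\<Sum>S\<in>?C - {?D}. a S * ?w S ?D) = 0"
      by (intro sum.neutral) auto
    then have "a ?D * ?w ?D ?D = 0"
      using rel standard_facet[OF assms(2)] sum.remove[OF fin, of ?D "\<lambda>S. a S * ?w S ?D"] by auto
    then show ?thesis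
      using det by simp
  qed
  have zero_cone: "a (insert m (?D - {j})) = 0" if m: "m \<in> {d + 2..n}" and j: "j \<in> {2..d + 1}" for m j
  proof -
    define u where "u F = (\<Sum>j\<in>{2..d + 1}. a (insert m (?D - {j})) * ?w (?D - {j}) F)" for F
    have mD: "m \<notin> ?D"
      using m by auto
    have inj: "inj_on (\<lambda>j. insert m (?D - {j})) {2..d + 1}"
    proof (rule inj_onI)
      fix i j assume ij: "i \<in> {2..d + 1}" "j \<in> {2..d + 1}"
        and eq: "insert m (?D - {i}) = insert m (?D - {j})"
      show "i = j"
        by (rule insert_Diff_singleton_inject[OF mD _ eq]) (use ij in auto)
    qed
    have u_zero: "u (?D - {i}) = 0" if i: "i \<in> {2..d + 1}" for i
    proof -
      let ?\<sigma> = "insert m (?D - {i})"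
      have sigma: "?\<sigma> - {m} = ?D - {i}" "{k\<in>?\<sigma>. m < k} = {}"
        using m by auto
      have "0 = (\<Sum>S\<in>?C. a S * ?w S ?\<sigma>)"
        using rel cone_facet[OF i m] by simp
      also have "\<dots> = (\<Sum>S\<in>(\<lambda>j. insert m (?D - {j})) ` {2..d + 1}. a S * ?w S ?\<sigma>)"
      proof (rule sum.mono_neutral_right)
        show "(\<lambda>j. insert m (?D - {j})) ` {2..d + 1} \<subseteq> ?C"
          using cone_facet m by blast
        show "\<forall>S\<in>?C - (\<lambda>j. insert m (?D - {j})) ` {2..d + 1}. a S * ?w S ?\<sigma> = 0"
        proof
          fix S assume S: "S \<in> ?C - (\<lambda>j. insert m (?D - {j})) ` {2..d + 1}"
          then have "S \<in> ?C"
            by blast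
          then show "a S * ?w S ?\<sigma> = 0"
          proof (cases rule: shifted_complex_facet_cases)
            case (2 j m')
            then have "m' \<noteq> m"
              using S by blast
            then have "m' \<notin> ?\<sigma>"
              using 2 by auto
            then show ?thesis
              using cone[of m' ?\<sigma> j] 2 by simp
          qed (use zero_std in simp)
        qed
      qed (rule fin)
      also have "\<dots> = (\<Sum>j\<in>{2..d + 1}. a (insert m (?D - {j})) * ?w (insert m (?D - {j})) ?\<sigma>)"
        by (rule sum.reindex_cong[OF inj]) (rule refl)+
      also have "\<dots> = u (?D - {i})"
        unfolding u_def
      proof (intro sum.cong refl)
        fix j
        have "?w (insert m (?D - {j})) ?\<sigma> = ?w (?D - {j}) (?D - {i})"
          using cone[of m ?\<sigma> j] m unfolding sigma by simp
        then show "a (insert m (?D - {j})) * ?w (insert m (?D - {j})) ?\<sigma> =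
            a (insert m (?D - {j})) * ?w (?D - {j}) (?D - {i})"
          by simp
      qed
      finally show ?thesis
        by simp
    qed
    have wedge_u: "wedge u v ?D = (\<Sum>j\<in>{2..d + 1}. a (insert m (?D - {j})) * wedge (?w (?D - {j})) v ?D)" for v
      unfolding u_def by (rule wedge_sum_left)
    \<comment> \<open>On the one hand this product is zero as the first frame vector is a factor of each term, on the
      other hand only the summand that removes 1 can be nonzero.\<close>
    have "wedge u (frame d p 1) ?D = 0"
      unfolding wedge_u by (intro sum.neutral ballI) (simp add: wedge_set_repeated)
    moreover have "wedge u (frame d p 1) ?D =
        (\<Sum>i\<in>?D. (-1) ^ card {k\<in>?D. i < k} * u (?D - {i}))"
      by (simp add: wedge_def frame_def)
    moreover have "\<dots> = (-1) ^ card {k\<in>?D. 1 < k} * u (?D - {1})"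
    proof -
      have "(\<Sum>i\<in>?D - {1}. (-1) ^ card {k\<in>?D. i < k} * u (?D - {i})) = 0"
      proof (rule sum.neutral, rule ballI)
        fix i assume "i \<in> ?D - {1}"
        then have "i \<in> {2..d + 1}"
          by auto
        then show "(-1) ^ card {k\<in>?D. i < k} * u (?D - {i}) = 0"
          using u_zero by simp
      qed
      then show ?thesis
        by (subst sum.remove[of ?D 1]) auto
    qed
    ultimately have u1: "u (?D - {1}) = 0"
      by simp
    have "u (?D - {i}) = 0" if "i \<in> ?D" for i
    proof (cases "i = 1")
      case False
      then have "i \<in> {2..d + 1}"
        using that by auto
      then show ?thesis
        by (rule u_zero)
    qed (use u1 in simp)
    then have "wedge u (frame d p j) ?D = 0"
      unfolding wedge_def by (intro sum.neutral) simp
    moreover have "wedge (?w (?D - {i})) (frame d p j) ?D = 0" if "i \<noteq> j" for i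
      using that j by (intro wedge_set_repeated) auto
    then have "wedge u (frame d p j) ?D = a (insert m (?D - {j})) * wedge (?w (?D - {j})) (frame d p j) ?D"
      unfolding wedge_u using j by (subst sum.remove[of "{2..d + 1}" j]) (auto intro!: sum.neutral)
    moreover obtain s where s: "s \<noteq> 0"
      "\<And>F. wedge (?w (?D - {j})) (frame d p j) F = s * ?w (insert j (?D - {j})) F"
      using wedge_set_insert[of "?D - {j}" j "frame d p"] by auto
    moreover have "insert j (?D - {j}) = ?D"
      using j by auto
    ultimately have "a (insert m (?D - {j})) * (s * ?w ?D ?D) = 0"
      by metis
    then show ?thesis
      using s(1) det by simp
  qed
  show "\<forall>S\<in>?C. a S = 0"
  proof
    fix S assume "S \<in> ?C"
    then show "a S = 0"
      by (cases rule: shifted_complex_facet_cases) (use zero_std zero_cone in simp_all)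
  qed
qed

text \<open>
  In matrix terms: the columns of the rigidity matrix and the products over the facets of the shifted
  complex span the same space. Write \<open>z j v\<close> for the pairing of \<open>c\<close> with the product of
  \<open>D - {j}\<close> and \<open>v\<close>, where \<open>D = {1..d + 1}\<close>. It is linear in \<open>v\<close>; at unit vectors it gives the pairing
  with the columns, at frame vectors the pairing with the products over facets (or zero).
  For the converse, the facets through \<open>m > d + 1\<close> give
  \<open>z j e\<^sub>m = 0\<close>, and what remains is a homogeneous linear system for the \<open>z j e\<^sub>i\<close>, \<open>i \<in> D\<close>, whose
  matrix has the volume of \<open>D\<close> as its determinant.
\<close>

lemma rigidity_stress_iff:
  assumes "d \<ge> 1" "d + 1 \<le> n" and vol: "volume_map d p {1..d + 1} \<noteq> 0"
    and S: "S \<subseteq> ground_set n d"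
  shows "(\<forall>v\<in>{1..n} \<times> {1..d}. (\<Sum>\<sigma>\<in>S. c \<sigma> * rigidity_matrix d p \<sigma> v) = 0) \<longleftrightarrow>
    (\<forall>F\<in>simplices (shifted_complex n d) d. (\<Sum>\<sigma>\<in>S. c \<sigma> * wedge_set (frame d p) F \<sigma>) = 0)"
    (is "?L \<longleftrightarrow> ?R")
proof -
  let ?D = "{1..d + 1}" and ?w = "wedge_set (frame d p)"
  define z where "z j v = (\<Sum>\<sigma>\<in>S. c \<sigma> * wedge (?w (?D - {j})) v \<sigma>)" for j v
  have sub: "card \<sigma> = d + 1 \<and> \<sigma> \<subseteq> {1..n}" if "\<sigma> \<in> S" for \<sigma>
    using S that by (auto simp: ground_set_def)
  have column: "(\<Sum>\<sigma>\<in>S. c \<sigma> * rigidity_matrix d p \<sigma> (i, j)) = 0 \<longleftrightarrow> z (j + 1) (unit_vector i) = 0"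
    if j: "j \<in> {1..d}" for i j
  proof -
    obtain s where s: "s \<noteq> 0"
      "\<And>\<sigma> i. card \<sigma> = d + 1 \<Longrightarrow> rigidity_matrix d p \<sigma> (i, j) = s * wedge (?w (?D - {j + 1})) (unit_vector i) \<sigma>"
      using rigidity_matrix_eq_wedge[OF j, of p] by blast
    have "(\<Sum>\<sigma>\<in>S. c \<sigma> * rigidity_matrix d p \<sigma> (i, j)) = s * z (j + 1) (unit_vector i)"
      unfolding z_def sum_distrib_left using s(2) sub by (intro sum.cong) auto
    then show ?thesis
      using s(1) by simp
  qed
  have expand: "z j v = (\<Sum>i\<in>{1..n}. v i * z j (unit_vector i))" for j v
  proof -
    have "z j v = (\<Sum>\<sigma>\<in>S. \<Sum>i\<in>{1..n}. c \<sigma> * (v i * wedge (?w (?D - {j})) (unit_vector i) \<sigma>))"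
      unfolding z_def
    proof (intro sum.cong refl)
      fix \<sigma> assume "\<sigma> \<in> S"
      then have "wedge (?w (?D - {j})) v \<sigma> = (\<Sum>i\<in>{1..n}. v i * wedge (?w (?D - {j})) (unit_vector i) \<sigma>)"
        using sub by (intro wedge_eq_sum_unit_vectors) auto
      then show "c \<sigma> * wedge (?w (?D - {j})) v \<sigma> =
          (\<Sum>i\<in>{1..n}. c \<sigma> * (v i * wedge (?w (?D - {j})) (unit_vector i) \<sigma>))"
        by (simp only: sum_distrib_left)
    qed
    then show ?thesis
      unfolding z_def sum_distrib_left
      by (subst (asm) sum.swap) (simp add: mult.left_commute)
  qed
  have vertex: "(\<Sum>\<sigma>\<in>S. c \<sigma> * ?w (insert m (?D - {j})) \<sigma>) = z j (unit_vector m)"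
    if "m \<in> {d + 2..n}" for m j
  proof -
    have "?w (insert m (?D - {j})) = wedge (?w (?D - {j})) (frame d p m)"
      using that by (intro wedge_set_insert_greater) auto
    moreover have "frame d p m = unit_vector m"
      using that by (auto simp: frame_def)
    ultimately show ?thesis
      by (simp add: z_def)
  qed
  have standard: "\<exists>s. s \<noteq> 0 \<and> z j (frame d p j) = s * (\<Sum>\<sigma>\<in>S. c \<sigma> * ?w ?D \<sigma>)" if j: "j \<in> ?D" for j
  proof -
    have "insert j (?D - {j}) = ?D"
      using j by auto
    moreover obtain s where s: "s \<noteq> 0"
      "\<And>F. wedge (?w (?D - {j})) (frame d p j) F = s * ?w (insert j (?D - {j})) F"
      using wedge_set_insert[of "?D - {j}" j "frame d p"] by auto
    ultimately have "z j (frame d p j) = s * (\<Sum>\<sigma>\<in>S. c \<sigma> * ?w ?D \<sigma>)"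
      unfolding z_def sum_distrib_left by (simp add: mult.left_commute)
    then show ?thesis
      using s(1) by blast
  qed
  have "?R" if zero: "?L"
  proof
    have z: "z j (unit_vector i) = 0" if ij: "i \<in> {1..n}" "j \<in> {2..d + 1}" for i j
    proof -
      have j: "j - 1 \<in> {1..d}" "j - 1 + 1 = j"
        using ij by auto
      then have "(\<Sum>\<sigma>\<in>S. c \<sigma> * rigidity_matrix d p \<sigma> (i, j - 1)) = 0"
        using zero ij by blast
      then show ?thesis
        using column[OF j(1), of i] unfolding j(2) by blast
    qed
    fix F assume "F \<in> simplices (shifted_complex n d) d"
    then show "(\<Sum>\<sigma>\<in>S. c \<sigma> * ?w F \<sigma>) = 0"
    proof (cases rule: shifted_complex_facet_cases)
      \<comment> \<open>Any column block would do to express the product over \<open>?D\<close>; the block of \<open>2\<close> exists because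
        \<open>d\<close> is positive.\<close>
      case 1
      have "2 \<in> ?D" "2 \<in> {2..d + 1}"
        using assms(1) by auto
      moreover from this have "z 2 (frame d p 2) = 0"
        using z by (subst expand) (auto intro!: sum.neutral)
      ultimately show ?thesis
        using standard[of 2] 1 by auto
    next
      case (2 j m)
      then show ?thesis
        using vertex[of m j] z[of m j] by auto
    qed
  qed
  moreover have "?L" if zero: "?R"
  proof
    fix v assume "v \<in> {1..n} \<times> {1..d}"
    then obtain i j where v: "v = (i, j)" and i: "i \<in> {1..n}" and j: "j \<in> {1..d}"
      by blast
    have j1: "j + 1 \<in> {2..d + 1}" "j + 1 \<in> ?D"
      using j by auto
    \<comment> \<open>The relation at the facets with a vertex above \<open>d + 1\<close> kills the pairings with the outer
      unit vectors, so only unknowns indexed by \<open>?D\<close> are left in the linear system.\<close>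
    have outer: "z (j + 1) (unit_vector m) = 0" if "m \<in> {d + 2..n}" for m
      using zero cone_facet[OF j1(1) that] vertex[OF that] by metis
    have frame_zero: "z (j + 1) (frame d p l) = 0" if l: "l \<in> ?D" for l
    proof (cases "l = j + 1")
      case True
      moreover have "(\<Sum>\<sigma>\<in>S. c \<sigma> * ?w ?D \<sigma>) = 0"
        using zero standard_facet[OF assms(2)] by blast
      ultimately show ?thesis
        using standard[OF j1(2)] by auto
    next
      case False
      then have "wedge (?w (?D - {j + 1})) (frame d p l) \<sigma> = 0" for \<sigma>
        using l by (intro wedge_set_repeated) auto
      then show ?thesis
        by (simp add: z_def)
    qed
    have "(\<Sum>i\<in>?D. frame d p l i * z (j + 1) (unit_vector i)) = 0" if l: "l \<in> ?D" for l
    proof -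
      have "(\<Sum>i\<in>{1..n}. frame d p l i * z (j + 1) (unit_vector i)) =
          (\<Sum>i\<in>?D. frame d p l i * z (j + 1) (unit_vector i))"
        using assms(2) outer by (intro sum.mono_neutral_right) auto
      then show ?thesis
        using frame_zero[OF l] expand[of "j + 1" "frame d p l"] by simp
    qed
    then have "z (j + 1) (unit_vector i) = 0" if "i \<in> ?D"
      using frame_nonsingular[OF vol, of "\<lambda>i. z (j + 1) (unit_vector i)"] that by blast
    moreover have "i \<in> ?D \<or> i \<in> {d + 2..n}"
      using i by auto
    ultimately have "z (j + 1) (unit_vector i) = 0"
      using outer by blast
    then show "(\<Sum>\<sigma>\<in>S. c \<sigma> * rigidity_matrix d p \<sigma> v) = 0"
      unfolding v using column[OF j] by blast
  qed
  ultimately show ?thesis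
    by blast
qed

lemma rigidity_matroid_eq:
  assumes "d \<ge> 1" "d + 1 \<le> n" "volume_map d p {1..d + 1} \<noteq> 0"
  shows "rigidity_matroid n d p = {S. S \<subseteq> ground_set n d \<and>
    independent_rows (\<lambda>\<sigma> F. wedge_set (frame d p) F \<sigma>) (simplices (shifted_complex n d) d) S}"
proof -
  have "rows_independent n d p S \<longleftrightarrow>
      independent_rows (\<lambda>\<sigma> F. wedge_set (frame d p) F \<sigma>) (simplices (shifted_complex n d) d) S"
    if "S \<subseteq> ground_set n d" for S
    unfolding rows_independent_def independent_rows_def rigidity_stress_iff[OF assms that] ..
  then show ?thesis
    unfolding rigidity_matroid_def by blast
qed

section \<open>Descending to lower-dimensional faces\<close>

text \<open>
  Multiplying a relation by the vector \<open>g r\<close> removes the faces that contain \<open>r\<close> and adds \<open>r\<close> to the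
  others; the result is a relation one dimension higher, provided that the enlarged sets are faces. The
  order of the multiplications matters when these sets are facets, as facets have to contain 1: first
  \<open>r = 1\<close> shows that only faces containing 1 occur in the relation, and then every \<open>r\<close> in
  \<open>{1..d + 1}\<close> may be used.
\<close>

lemma shifted_wedges_independent_on_complex:
  assumes closed: "\<And>\<sigma> \<tau>. \<sigma> \<in> \<Sigma> \<Longrightarrow> \<tau> \<subseteq> \<sigma> \<Longrightarrow> \<tau> \<in> \<Sigma>"
    and facets: "independent_rows (wedge_set g) (simplices \<Sigma> d) (simplices (shifted_complex n d) d)"
    and n: "d + 1 \<le> n" and k: "k \<le> d"
  shows "independent_rows (wedge_set g) (simplices \<Sigma> k) (simplices (shifted_complex n d) k)"
  using k
proof (induction k rule: inc_induct)
  case base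
  then show ?case
    by (rule facets)
next
  case (step k)
  let ?C = "\<lambda>k. simplices (shifted_complex n d) k" and ?w = "wedge_set g"
  show ?case
    unfolding independent_rows_def
  proof (intro allI impI)
    fix a
    assume rel: "\<forall>\<sigma>\<in>simplices \<Sigma> k. (\<Sum>S\<in>?C k. a S * ?w S \<sigma>) = 0"
    have fin: "finite (?C k)" for k
      by (rule finite_simplices_shifted_complex)
    have multiply: "\<forall>S\<in>?C k. r \<notin> S \<longrightarrow> a S = 0"
      if r: "r \<in> {1..d + 1}" and one: "\<And>S. S \<in> ?C k \<Longrightarrow> a S \<noteq> 0 \<Longrightarrow> 1 \<in> S \<or> r = 1" for r
    proof -
      define A where "A = {S \<in> ?C k. r \<notin> S \<and> a S \<noteq> 0}"
      have finA: "finite A" and A: "A \<subseteq> ?C k"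
        using fin by (auto simp: A_def)
      have finS: "finite S" if "S \<in> ?C k" for S
        using that by (auto simp: simplices_def intro: card_ge_0_finite)
      have "\<exists>s. s \<noteq> 0 \<and> (\<forall>F. wedge (?w S) (g r) F = s * ?w (insert r S) F)" if "S \<in> A" for S
      proof -
        have "finite S" "r \<notin> S"
          using that finS by (auto simp: A_def)
        then show ?thesis
          using wedge_set_insert[of S r g] by blast
      qed
      then obtain s where s: "\<And>S. S \<in> A \<Longrightarrow> s S \<noteq> 0"
        "\<And>S F. S \<in> A \<Longrightarrow> wedge (?w S) (g r) F = s S * ?w (insert r S) F"
        by metis
      have inj: "inj_on (insert r) A"
        by (rule inj_onI) (auto simp: A_def)
      have sub: "insert r ` A \<subseteq> ?C (Suc k)"
      proof
        fix T assume "T \<in> insert r ` A"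
        then obtain S where "S \<in> A" "T = insert r S"
          by blast
        then show "T \<in> ?C (Suc k)"
          using shifted_complex_insert[of S n d k r] one[of S] r n step.hyps by (auto simp: A_def)
      qed
      \<comment> \<open>The coefficients of the relation obtained by multiplying with \<open>g r\<close>, indexed by the enlarged
        faces.\<close>
      define b where "b T = (if T \<in> insert r ` A then a (T - {r}) * s (T - {r}) else 0)" for T
      have b: "b (insert r S) = a S * s S" if "S \<in> A" for S
        using that by (auto simp: b_def A_def)
      have "(\<Sum>T\<in>?C (Suc k). b T * ?w T F) = 0" if F: "F \<in> simplices \<Sigma> (Suc k)" for F
      proof -
        have "(\<Sum>T\<in>?C (Suc k). b T * ?w T F) = (\<Sum>T\<in>insert r ` A. b T * ?w T F)"
          using fin sub by (intro sum.mono_neutral_right) (auto simp: b_def)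
        also have "\<dots> = (\<Sum>S\<in>A. a S * wedge (?w S) (g r) F)"
          using inj b s(2) by (simp add: sum.reindex mult.assoc)
        also have "\<dots> = (\<Sum>S\<in>?C k. a S * wedge (?w S) (g r) F)"
        proof (rule sum.mono_neutral_left)
          show "\<forall>S\<in>?C k - A. a S * wedge (?w S) (g r) F = 0"
            using finS by (auto simp: A_def wedge_set_repeated)
        qed (use fin A in auto)
        also have "\<dots> = wedge (\<lambda>F. \<Sum>S\<in>?C k. a S * ?w S F) (g r) F"
          by (rule wedge_sum_left[symmetric])
        also have "\<dots> = 0"
          unfolding wedge_def
        proof (rule sum.neutral, rule ballI)
          fix i assume i: "i \<in> F"
          have "F \<in> \<Sigma>" "card F = Suc k + 1"
            using F by (auto simp: simplices_def)
          then have "F - {i} \<in> simplices \<Sigma> k"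
            using closed[of F "F - {i}"] i by (simp add: simplices_def)
          then show "(-1) ^ card {j\<in>F. i < j} * g r i * (\<Sum>S\<in>?C k. a S * ?w S (F - {i})) = 0"
            using rel by simp
        qed
        finally show ?thesis .
      qed
      then have "\<forall>T\<in>?C (Suc k). b T = 0"
        using step.IH unfolding independent_rows_def by blast
      then have "a S * s S = 0" if "S \<in> A" for S
        using b[OF that] sub that by (metis image_subset_iff)
      then have "A = {}"
        using s(1) by (auto simp: A_def)
      then show ?thesis
        by (auto simp: A_def)
    qed
    have one: "1 \<in> S" if "S \<in> ?C k" "a S \<noteq> 0" for S
      using multiply[of 1] that by auto
    show "\<forall>S\<in>?C k. a S = 0"
    proof (rule ballI, rule ccontr)
      fix S assume S: "S \<in> ?C k" "a S \<noteq> 0"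
      then have card: "card S = k + 1"
        by (simp add: simplices_def)
      then have "finite S"
        by (simp add: card_ge_0_finite)
      then have "\<not> {1..d + 1} \<subseteq> S"
        using step.hyps card card_mono[of S "{1..d + 1}"] by auto
      then obtain r where "r \<in> {1..d + 1}" "r \<notin> S"
        by blast
      then show False
        using multiply[of r] one S by blast
    qed
  qed
qed

section \<open>Generic configurations have nonzero volume\<close>

text \<open>
  The monomial of the permutation \<open>\<pi>\<close> in the Leibniz formula for the volume of \<open>{1..d + 1}\<close>. Columns
  of the determinant are numbered from 0 and points from 1, whence \<open>\<pi> j + 1\<close>. Row 0 consists of ones
  and contributes no variable.
\<close>

definition leibniz_monomial :: "nat \<Rightarrow> (nat \<Rightarrow> nat) \<Rightarrow> (nat \<times> nat) \<Rightarrow>\<^sub>0 nat" where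
  "leibniz_monomial d \<pi> = (\<Sum>j\<in>{1..d}. Poly_Mapping.single (\<pi> j + 1, j) 1)"

definition volume_polynomial :: "nat \<Rightarrow> rat_mpoly" where
  "volume_polynomial d = (\<Sum>\<pi> | \<pi> permutes {0..<d + 1}.
     Poly_Mapping.single (leibniz_monomial d \<pi>) (of_int (sign \<pi>)))"

lemma lookup_leibniz_monomial:
  "Poly_Mapping.lookup (leibniz_monomial d \<pi>) (i, j) = (if j \<in> {1..d} \<and> i = \<pi> j + 1 then 1 else 0)"
proof -
  have "Poly_Mapping.lookup (leibniz_monomial d \<pi>) (i, j) =
      (\<Sum>l\<in>{1..d}. if l = j then if i = \<pi> j + 1 then 1 else 0 else 0)"
    unfolding leibniz_monomial_def lookup_sum by (intro sum.cong) (auto simp: lookup_single when_def)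
  then show ?thesis
    by simp
qed

lemma keys_leibniz_monomial: "Poly_Mapping.keys (leibniz_monomial d \<pi>) = (\<lambda>j. (\<pi> j + 1, j)) ` {1..d}"
  by (auto simp: in_keys_iff lookup_leibniz_monomial split: if_splits)

text \<open>
  The monomial determines the permutation on all rows but row 0, and a bijection is determined
  by its values at all arguments but one. So no cancellation occurs in the Leibniz formula.
\<close>

lemma inj_on_leibniz_monomial: "inj_on (leibniz_monomial d) {\<pi>. \<pi> permutes {0..<d + 1}}"
proof (rule inj_onI, clarify)
  fix \<pi> \<rho> assume perm: "\<pi> permutes {0..<d + 1}" "\<rho> permutes {0..<d + 1}"
    and eq: "leibniz_monomial d \<pi> = leibniz_monomial d \<rho>"
  have agree: "\<pi> j = \<rho> j" if "j \<in> {1..d}" for j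
    using lookup_leibniz_monomial[of d \<pi> "\<pi> j + 1" j] lookup_leibniz_monomial[of d \<rho> "\<pi> j + 1" j] eq that
    by (auto split: if_splits)
  have first: "{\<sigma> 0} = {0..<d + 1} - \<sigma> ` {1..d}" if "\<sigma> permutes {0..<d + 1}" for \<sigma>
  proof -
    have "{0..<d + 1} - {1..d} = {0}"
      by auto
    then have "\<sigma> ` {0} = {0..<d + 1} - \<sigma> ` {1..d}"
      using image_set_diff[OF permutes_inj[OF that], of "{0..<d + 1}" "{1..d}"]
      by (simp only: permutes_image[OF that])
    then show ?thesis
      by simp
  qed
  have "\<pi> ` {1..d} = \<rho> ` {1..d}"
    using agree by (intro image_cong) auto
  then have "\<pi> 0 = \<rho> 0"
    using first perm by (metis singleton_inject)
  then show "\<pi> = \<rho>"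
  proof (intro ext)
    fix j
    show "\<pi> j = \<rho> j"
    proof (cases "j \<in> {0..<d + 1}")
      case True
      then show ?thesis
        using agree \<open>\<pi> 0 = \<rho> 0\<close> by (cases "j = 0") auto
    next
      case False
      then show ?thesis
        using perm by (simp add: permutes_not_in)
    qed
  qed
qed

lemma lookup_volume_polynomial:
  assumes "\<pi> permutes {0..<d + 1}"
  shows "Poly_Mapping.lookup (volume_polynomial d) (leibniz_monomial d \<pi>) = of_int (sign \<pi>)"
proof -
  have "Poly_Mapping.lookup (volume_polynomial d) (leibniz_monomial d \<pi>) =
      (\<Sum>\<rho> | \<rho> permutes {0..<d + 1}. if \<rho> = \<pi> then of_int (sign \<pi>) else 0)"
    unfolding volume_polynomial_def lookup_sum
    using inj_on_leibniz_monomial[of d] assms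
    by (intro sum.cong refl) (auto simp: lookup_single when_def inj_on_def)
  then show ?thesis
    using assms by (simp add: finite_permutations)
qed

lemma keys_volume_polynomial:
  "Poly_Mapping.keys (volume_polynomial d) = leibniz_monomial d ` {\<pi>. \<pi> permutes {0..<d + 1}}"
proof (intro subset_antisym subsetI)
  fix m assume "m \<in> Poly_Mapping.keys (volume_polynomial d)"
  then have "Poly_Mapping.lookup (volume_polynomial d) m \<noteq> 0"
    by (simp add: in_keys_iff)
  then obtain \<pi> where "\<pi> permutes {0..<d + 1}"
    "Poly_Mapping.lookup (Poly_Mapping.single (leibniz_monomial d \<pi>) (of_int (sign \<pi>) :: rat)) m \<noteq> 0"
    unfolding volume_polynomial_def lookup_sum by (metis (no_types, lifting) mem_Collect_eq sum.neutral)
  then show "m \<in> leibniz_monomial d ` {\<pi>. \<pi> permutes {0..<d + 1}}"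
    by (auto simp: lookup_single when_def split: if_splits)
next
  fix m assume "m \<in> leibniz_monomial d ` {\<pi>. \<pi> permutes {0..<d + 1}}"
  then show "m \<in> Poly_Mapping.keys (volume_polynomial d)"
    by (auto simp: in_keys_iff lookup_volume_polynomial sign_def split: if_splits)
qed

lemma mpoly_eval_volume_polynomial:
  "mpoly_eval p (volume_polynomial d) = volume_map d p {1..d + 1}"
proof -
  let ?P = "{\<pi>. \<pi> permutes {0..<d + 1}}"
  define A where "A = Matrix.mat (d + 1) (d + 1)
       (\<lambda>(r, c). if r = 0 then 1 else p (sorted_list_of_set {1..d + 1} ! c) r)"
  have A: "A \<in> carrier_mat (d + 1) (d + 1)"
    by (simp add: A_def)
  have entry: "A $$ (r, c) = (if r = 0 then 1 else p (c + 1) r)" if "r < d + 1" "c < d + 1" for r c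
    using that unfolding A_def sorted_list_of_set_1_upto by (simp del: upt_Suc)
  have mono: "(\<Prod>(i, j)\<in>Poly_Mapping.keys (leibniz_monomial d \<pi>).
      p i j ^ Poly_Mapping.lookup (leibniz_monomial d \<pi>) (i, j)) = (\<Prod>i = 0..<d + 1. A $$ (i, \<pi> i))"
    if pi: "\<pi> permutes {0..<d + 1}" for \<pi>
  proof -
    have "(\<Prod>(i, j)\<in>Poly_Mapping.keys (leibniz_monomial d \<pi>).
        p i j ^ Poly_Mapping.lookup (leibniz_monomial d \<pi>) (i, j)) = (\<Prod>j\<in>{1..d}. p (\<pi> j + 1) j)"
      unfolding keys_leibniz_monomial
      by (subst prod.reindex) (auto simp: inj_on_def lookup_leibniz_monomial intro!: prod.cong)
    also have "\<dots> = (\<Prod>i\<in>{1..d}. A $$ (i, \<pi> i))"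
    proof (intro prod.cong refl)
      fix i assume i: "i \<in> {1..d}"
      then have "\<pi> i < d + 1"
        using permutes_in_image[OF pi, of i] by auto
      then show "p (\<pi> i + 1) i = A $$ (i, \<pi> i)"
        using entry[of i "\<pi> i"] i by auto
    qed
    also have "\<dots> = (\<Prod>i = 0..<d + 1. A $$ (i, \<pi> i))"
    proof -
      have "{0..<d + 1} = insert 0 {1..d}"
        by auto
      moreover have "A $$ (0, \<pi> 0) = 1"
        using entry[of 0 "\<pi> 0"] permutes_in_image[OF pi, of 0] by auto
      ultimately show ?thesis
        by simp
    qed
    finally show ?thesis .
  qed
  have "mpoly_eval p (volume_polynomial d) =
      (\<Sum>\<pi>\<in>?P. of_int (sign \<pi>) * (\<Prod>i = 0..<d + 1. A $$ (i, \<pi> i)))"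
    unfolding mpoly_eval_def keys_volume_polynomial sum.reindex[OF inj_on_leibniz_monomial]
    using mono by (intro sum.cong refl) (simp add: lookup_volume_polynomial)
  then show ?thesis
    using det_def'[OF A] by (simp only: volume_map_def A_def)
qed

lemma generic_volume_nonzero:
  assumes "generic n d p" "d + 1 \<le> n"
  shows "volume_map d p {1..d + 1} \<noteq> 0"
proof -
  have "leibniz_monomial d id \<in> Poly_Mapping.keys (volume_polynomial d)"
    unfolding keys_volume_polynomial using permutes_id by blast
  then have "volume_polynomial d \<noteq> 0"
    by auto
  moreover have "mpoly_vars (volume_polynomial d) \<subseteq> {1..n} \<times> {1..d}"
  proof
    fix v assume "v \<in> mpoly_vars (volume_polynomial d)"
    then obtain \<pi> j where "\<pi> permutes {0..<d + 1}" and j: "j \<in> {1..d}" and v: "v = (\<pi> j + 1, j)"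
      by (auto simp: mpoly_vars_def keys_volume_polynomial keys_leibniz_monomial)
    then have "\<pi> j < d + 1"
      using permutes_in_image[of \<pi> "{0..<d + 1}" j] by auto
    then show "v \<in> {1..n} \<times> {1..d}"
      using v j assms(2) by auto
  qed
  ultimately show ?thesis
    using assms(1) mpoly_eval_volume_polynomial unfolding generic_def by metis
qed

section \<open>The bound on the face numbers\<close>

theorem theorem3p3:
  fixes n d k :: nat
  assumes "d \<ge> 1" and "k \<le> d"
  shows "(\<forall>\<Sigma> p. dim_complex n d \<Sigma> \<and> generic n d p
              \<and> basis_of (rigidity_matroid n d p) (simplices \<Sigma> d)
            \<longrightarrow> f_vec \<Sigma> k \<ge> face_bound n d k)
       \<and> (n \<ge> d + 1 \<longrightarrow>
            (\<exists>\<Sigma>. dim_complex n d \<Sigma>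
               \<and> (\<forall>p. generic n d p \<longrightarrow> basis_of (rigidity_matroid n d p) (simplices \<Sigma> d))
               \<and> f_vec \<Sigma> k = face_bound n d k))"
proof (intro conjI allI impI)
  fix \<Sigma> p
  assume "dim_complex n d \<Sigma> \<and> generic n d p \<and> basis_of (rigidity_matroid n d p) (simplices \<Sigma> d)"
  then have complex: "dim_complex n d \<Sigma>" and generic: "generic n d p"
    and basis: "basis_of (rigidity_matroid n d p) (simplices \<Sigma> d)"
    by blast+
  let ?C = "simplices (shifted_complex n d)" and ?w = "wedge_set (frame d p)"
  have closed: "\<tau> \<in> \<Sigma>" if "\<sigma> \<in> \<Sigma>" "\<tau> \<subseteq> \<sigma>" for \<sigma> \<tau>
    using complex that unfolding dim_complex_def simplicial_complex_def by metis
  have vertices: "\<sigma> \<subseteq> {1..n}" if "\<sigma> \<in> \<Sigma>" for \<sigma>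
    using complex that unfolding dim_complex_def simplicial_complex_def by blast
  obtain \<sigma> where "\<sigma> \<in> \<Sigma>" "card \<sigma> = d + 1"
    using complex by (auto simp: dim_complex_def simplices_def)
  then have n: "d + 1 \<le> n"
    using card_mono[of "{1..n}" \<sigma>] vertices by simp
  have vol: "volume_map d p {1..d + 1} \<noteq> 0"
    using generic_volume_nonzero[OF generic n] .
  have "independent_rows ?w (simplices \<Sigma> d) (?C d)"
    unfolding independent_rows_def
  proof (intro allI impI)
    fix a
    assume "\<forall>\<sigma>\<in>simplices \<Sigma> d. (\<Sum>F\<in>?C d. a F * ?w F \<sigma>) = 0"
    then have "(\<Sum>F\<in>?C d. a F * ?w F \<sigma>) = 0" if "\<sigma> \<in> ground_set n d" for \<sigma>
      using basis_rows_detect_column_relations[of "ground_set n d" "\<lambda>\<sigma> F. ?w F \<sigma>" "?C d"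
          "simplices \<Sigma> d" a \<sigma>] basis that
      by (simp add: rigidity_matroid_eq[OF assms(1) n vol] finite_ground_set
          finite_simplices_shifted_complex)
    then show "\<forall>F\<in>?C d. a F = 0"
      using facet_wedges_independent[OF assms(1) n vol] simplices_shifted_complex_subset_ground_set
      unfolding independent_rows_def by blast
  qed
  then have "independent_rows ?w (simplices \<Sigma> k) (?C k)"
    by (rule shifted_wedges_independent_on_complex[OF _ _ n assms(2), rotated]) (rule closed)
  moreover have "finite (simplices \<Sigma> k)"
    by (rule finite_subset[of _ "Pow {1..n}"]) (use vertices in \<open>auto simp: simplices_def\<close>)
  ultimately have "card (?C k) \<le> card (simplices \<Sigma> k)"
    using independent_rows_card_le finite_simplices_shifted_complex by blast
  then show "face_bound n d k \<le> f_vec \<Sigma> k"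
    using f_vec_shifted_complex[OF assms(1) n assms(2)] by (simp add: f_vec_def)
next
  assume n: "n \<ge> d + 1"
  have "basis_of (rigidity_matroid n d p) (simplices (shifted_complex n d) d)"
    if generic: "generic n d p" for p
  proof -
    have vol: "volume_map d p {1..d + 1} \<noteq> 0"
      using generic_volume_nonzero[OF generic n] .
    show ?thesis
      unfolding rigidity_matroid_eq[OF assms(1) n vol]
      using facet_wedges_independent[OF assms(1) n vol] simplices_shifted_complex_subset_ground_set
        finite_ground_set finite_simplices_shifted_complex
      by (intro square_nonsingular_basis) simp_all
  qed
  then show "\<exists>\<Sigma>. dim_complex n d \<Sigma>
               \<and> (\<forall>p. generic n d p \<longrightarrow> basis_of (rigidity_matroid n d p) (simplices \<Sigma> d))
               \<and> f_vec \<Sigma> k = face_bound n d k"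
    using dim_complex_shifted_complex[OF assms(1) n] f_vec_shifted_complex[OF assms(1) n assms(2)]
    by blast
qed

end
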